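(* For every summable function $\psi\in L_1((A,B)\times(C,D))$ the integral operator $\mathbb{I}$ satisfies the semigroup property $$\left({}_{A^+,C^+}\mathbb{I}_{\varkappa,\varrho,\Upsilon,\nu_1,\nu_2}^{(\gamma_1;\gamma_2;\frac{\gamma_1+1}{2};\gamma_2)}\;{}_{A^+,C^+}\mathbb{I}_{\sigma,\eta,\Upsilon,\nu_1,\nu_2}^{(\mu_1;\mu_2;\frac{\mu_1+1}{2};\mu_2)}\psi\right)(X,Y)=\left({}_{A^+,C^+}\mathbb{I}_{\varkappa+\sigma,\varrho+\eta,\Upsilon,\nu_1,\nu_2}^{(\gamma_1+\mu_1;\gamma_2+\mu_2;\frac{\gamma_1+\mu_1+1}{2};\gamma_2+\mu_2)}\psi\right)(X,Y).$$ In particular, $$\left({}_{A^+,C^+}\mathbb{I}_{\varkappa,\varrho,\Upsilon,\nu_1,\nu_2}^{(\gamma_1;\gamma_2;\frac{\gamma_1+1}{2};\gamma_2)}\;{}_{A^+,C^+}\mathbb{I}_{\sigma,\eta,\Upsilon,\nu_1,\nu_2}^{(-\gamma_1;-\gamma_2;\frac{-\gamma_1+1}{2};-\gamma_2)}\psi\right)(X,Y)=\left({}_{A^+,C^+}\mathbb{I}_{\varkappa+\sigma,\varrho+\eta,\Upsilon,\nu_1,\nu_2}^{(0;0;\frac12;0)}\psi\right)(X,Y)={}_{Y}I_{C^+}^{\varrho+\eta}\,{}_{X}I_{A^+}^{\varkappa+\sigma}\psi(X,Y).$$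
   Context: $(a)_k$ is the Pochhammer symbol. The modified bivariate H–K Mittag-Leffler function is $$E_{\varkappa,\varrho,\Upsilon}^{(\gamma_1;\gamma_2;\gamma_3;\gamma_4)}(X,Y)=\sum_{s=0}^\infty\sum_{r=0}^\infty\frac{(\gamma_1)_{2s}(\gamma_2)_{s+r}X^sY^{\Upsilon r}}{(\gamma_3)_s(\gamma_4)_s\Gamma(\varkappa+s)\Gamma(\varrho+\Upsilon r)\,r!\,s!},$$ defined for complex $\Upsilon,\varkappa,\varrho,\gamma_1,\gamma_2,\gamma_3,\gamma_4$ with positive real parts. The integral operator is, for $X>A$, $Y>C$, $$\left({}_{A^+,C^+}\mathbb{I}_{\varkappa,\varrho,\Upsilon,\nu_1,\nu_2}^{(\gamma_1;\gamma_2;\gamma_3;\gamma_4)}\psi\right)(X,Y)=\int_C^Y\int_A^X(X-t)^{\varkappa-1}(Y-\Omega)^{\varrho-1}E_{\varkappa,\varrho,\Upsilon}^{(\gamma_1;\gamma_2;\gamma_3;\gamma_4)}(\nu_1(X-t),\nu_2(Y-\Omega))\,\psi(t,\Omega)\,dt\,d\Omega,$$ with constants $\nu_1,\nu_2$; the parameters $\varkappa,\varrho,\sigma,\eta,\Upsilon$ have positive real parts and $\gamma_i,\mu_i$ are the upper parameters of the two operators. In the second identity the same defining formulas are used with the upper parameters $(-\gamma_1;-\gamma_2;\frac{-\gamma_1+1}{2};-\gamma_2)$ and $(0;0;\frac12;0)$. The space $L_1((A,B)\times(C,D))$ consists of $f$ with $\int_A^B\int_C^D|f(X,Y)|\,dY\,dX<\infty$.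 The Riemann–Liouville double fractional integral is $$({}_{Y}I_{C^+}^{\zeta}\,{}_{X}I_{A^+}^{\mu})g(X,Y)=\frac{1}{\Gamma(\zeta)\Gamma(\mu)}\int_C^Y\int_A^X(X-\epsilon)^{\mu-1}(Y-\Omega)^{\zeta-1}g(\epsilon,\Omega)\,d\epsilon\,d\Omega,$$ for $\mathrm{Re}(\zeta),\mathrm{Re}(\mu)>0$.
   Formalization: In the second identity, coefficients of E that have the form 0/0 (e.g. for the upper parameters (0;0;1/2;0)) are read as their limits within the family (a;b;(a+1)/2;b); equalities for ψ in L_1 hold for almost every (X,Y). *)

theory Defs
  imports "HOL-Analysis.Analysis"
begin

definition hk_quotient ::
    "complex \<Rightarrow> complex \<Rightarrow> complex \<Rightarrow> complex \<Rightarrow> nat \<Rightarrow> nat \<Rightarrow> complex" where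
  "hk_quotient g1 g2 g3 g4 s r =
     (pochhammer g1 (2 * s) * pochhammer g2 (s + r)) / (pochhammer g3 s * pochhammer g4 s)"

text \<open>
  If \<open>g3\<close> or \<open>g4\<close> is a nonpositive integer, the quotient above can take the form \<open>0/0\<close>. This
  happens for upper parameters such as \<open>(0; 0; 1/2; 0)\<close>, and for
  \<open>(-a; -b; (-a+1)/2; -b)\<close> if \<open>b\<close> is a positive integer or \<open>a\<close> an odd positive integer.
  The quotient is then read as its limiting value. The shift \<open>(2e, e, e, e)\<close> stays inside the family
  \<open>(a; b; (a+1)/2; b)\<close>, and on that family the singularity is removable, see
  \<open>hk_coeff_family\<close> below. If \<open>g3\<close> and \<open>g4\<close> have positive real parts,
  the second branch is never used.
\<close>

definition hk_coeff ::
    "complex \<Rightarrow> complex \<Rightarrow> complex \<Rightarrow> complex \<Rightarrow> nat \<Rightarrow> nat \<Rightarrow> complex" where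
  "hk_coeff g1 g2 g3 g4 s r =
     (if pochhammer g3 s * pochhammer g4 s \<noteq> 0 then hk_quotient g1 g2 g3 g4 s r
      else Lim (at 0) (\<lambda>e. hk_quotient (g1 + 2 * e) (g2 + e) (g3 + e) (g4 + e) s r))"

lemma hk_quotient_family:
  assumes "pochhammer ((a + 1) / 2) s \<noteq> 0" "pochhammer b s \<noteq> 0"
  shows "hk_quotient a b ((a + 1) / 2) b s r =
           4 ^ s * pochhammer (a / 2) s * pochhammer (b + of_nat s) r"
proof -
  have "pochhammer a (2 * s) = 4 ^ s * pochhammer (a / 2) s * pochhammer ((a + 1) / 2) s"
    using pochhammer_double[of "a / 2" s] by (simp add: power_mult add_divide_distrib)
  moreover have "pochhammer b (s + r) = pochhammer b s * pochhammer (b + of_nat s) r"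
    by (rule pochhammer_product')
  ultimately show ?thesis
    using assms by (simp add: hk_quotient_def)
qed

lemma hk_coeff_family:
  "hk_coeff a b ((a + 1) / 2) b s r = 4 ^ s * pochhammer (a / 2) s * pochhammer (b + of_nat s) r"
proof (cases "pochhammer ((a + 1) / 2) s * pochhammer b s = 0")
  case False
  then show ?thesis by (simp add: hk_coeff_def hk_quotient_family)
next
  case True
  have nz: "eventually (\<lambda>e. pochhammer (c + e) s \<noteq> 0) (at 0)" for c :: complex
  proof -
    have "eventually (\<lambda>e. \<forall>k\<in>{..<s}. e \<noteq> - c - of_nat k) (at 0)"
      by (intro eventually_ball_finite ballI eventually_neq_at_within) auto
    then show ?thesis
      by eventually_elim (auto simp: pochhammer_eq_0_iff algebra_simps eq_neg_iff_add_eq_0)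
  qed
  let ?q = "\<lambda>e. hk_quotient (a + 2 * e) (b + e) ((a + 1) / 2 + e) (b + e) s r"
  let ?p = "\<lambda>e. 4 ^ s * pochhammer (a / 2 + e) s * pochhammer (b + e + of_nat s) r"
  have ev: "eventually (\<lambda>e. ?p e = ?q e) (at 0)"
    using nz[of "(a + 1) / 2"] nz[of b]
  proof eventually_elim
    case (elim e)
    have "(a + 2 * e + 1) / 2 = (a + 1) / 2 + e" "(a + 2 * e) / 2 = a / 2 + e"
      by (simp_all add: field_simps)
    with elim hk_quotient_family[of "a + 2 * e" s "b + e" r] show ?case by simp
  qed
  have "(?p \<longlongrightarrow> ?p 0) (at 0)"
    unfolding pochhammer_prod by (intro tendsto_intros)
  then have "(?q \<longlongrightarrow> ?p 0) (at 0)"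
    by (rule Lim_transform_eventually) (rule ev)
  then have "Lim (at 0) ?q = ?p 0"
    by (intro tendsto_Lim) auto
  with True show ?thesis by (simp add: hk_coeff_def)
qed

text \<open>
  \<open>(Y powr U) ^ r\<close> is the principal value of \<open>Y\<close> to the power \<open>U * r\<close>; writing
  \<open>Y powr (U * of_nat r)\<close> instead would give \<open>0 powr 0 = 0\<close> for \<open>Y = 0\<close>, \<open>r = 0\<close>.
\<close>

definition hk_mittag_leffler ::
    "complex \<Rightarrow> complex \<Rightarrow> complex \<Rightarrow> complex \<Rightarrow> complex \<Rightarrow> complex \<Rightarrow> complex \<Rightarrow>
     complex \<Rightarrow> complex \<Rightarrow> complex" where
  "hk_mittag_leffler \<kappa> \<rho> U g1 g2 g3 g4 X Y =
     (\<Sum>s. \<Sum>r. hk_coeff g1 g2 g3 g4 s r * X ^ s * (Y powr U) ^ r /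
        (Gamma (\<kappa> + of_nat s) * Gamma (\<rho> + U * of_nat r) * fact r * fact s))"

definition hk_integral ::
    "real \<Rightarrow> real \<Rightarrow> complex \<Rightarrow> complex \<Rightarrow> complex \<Rightarrow> complex \<Rightarrow> complex \<Rightarrow>
     complex \<Rightarrow> complex \<Rightarrow> complex \<Rightarrow> complex \<Rightarrow>
     (real \<Rightarrow> real \<Rightarrow> complex) \<Rightarrow> real \<Rightarrow> real \<Rightarrow> complex" where
  "hk_integral A C \<kappa> \<rho> U \<nu>1 \<nu>2 g1 g2 g3 g4 \<psi> X Y =
     (LINT w:{C<..<Y}|lebesgue. (LINT t:{A<..<X}|lebesgue.
        of_real (X - t) powr (\<kappa> - 1) * of_real (Y - w) powr (\<rho> - 1) *
        hk_mittag_leffler \<kappa> \<rho> U g1 g2 g3 g4 (\<nu>1 * of_real (X - t)) (\<nu>2 * of_real (Y - w)) *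
        \<psi> t w))"

text \<open>\<open>\<zeta>\<close> is the order in the second variable and \<open>\<mu>\<close> the order in the first one.\<close>

definition rl_double_integral ::
    "real \<Rightarrow> real \<Rightarrow> complex \<Rightarrow> complex \<Rightarrow>
     (real \<Rightarrow> real \<Rightarrow> complex) \<Rightarrow> real \<Rightarrow> real \<Rightarrow> complex" where
  "rl_double_integral A C \<zeta> \<mu> g X Y =
     1 / (Gamma \<zeta> * Gamma \<mu>) *
     (LINT w:{C<..<Y}|lebesgue. (LINT t:{A<..<X}|lebesgue.
        of_real (X - t) powr (\<mu> - 1) * of_real (Y - w) powr (\<zeta> - 1) * g t w))"

definition L1_rect :: "real \<Rightarrow> real \<Rightarrow> real \<Rightarrow> real \<Rightarrow> (real \<Rightarrow> real \<Rightarrow> complex) \<Rightarrow> bool" where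
  "L1_rect A B C D f \<longleftrightarrow>
     set_integrable lebesgue ({A<..<B} \<times> {C<..<D}) (\<lambda>(x, y). f x y)"

text \<open>
  Functions in \<open>L1\<close> are determined up to null sets, and so are the operators applied to them:
  identities between them are identities for almost every point of the rectangle.
\<close>

definition ae_eq_rect ::
    "real \<Rightarrow> real \<Rightarrow> real \<Rightarrow> real \<Rightarrow> (real \<Rightarrow> real \<Rightarrow> complex) \<Rightarrow> (real \<Rightarrow> real \<Rightarrow> complex) \<Rightarrow> bool" where
  "ae_eq_rect A B C D f g \<longleftrightarrow>
     (AE (x, y) in lebesgue. (x, y) \<in> {A<..<B} \<times> {C<..<D} \<longrightarrow> f x y = g x y)"

end

theory Submission
  imports Defs
begin

text \<open>
  For the upper parameters \<open>(a; b; (a + 1) / 2; b)\<close> the duplication formula turns the kernel of the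
  operator into a double series of products \<open>p\<^bsub>\<kappa>+s\<^esub>(x) p\<^bsub>\<rho>+Ur\<^esub>(y)\<close> of Riemann--Liouville kernels
  \<open>p\<^bsub>a\<^esub>(t) = t\<^bsup>a-1\<^esup> / \<Gamma>(a)\<close>, with coefficients
  \<open>4\<^bsup>s\<^esup> (a/2)\<^sub>s (b+s)\<^sub>r / (s! r!)\<close> times powers of constants. The kernels \<open>p\<^bsub>a\<^esub>\<close> form a convolution
  semigroup and, by the Vandermonde identity, the coefficients form one under the two-dimensional
  Cauchy product, so convolving two such series adds all parameters. The operator is convolution
  with its kernel; hence the semigroup law is associativity of convolution in \<open>L\<^sup>1\<close>, which holds almost
  everywhere by Fubini. For \<open>a = b = 0\<close> only the term \<open>s = r = 0\<close> is left, and the operator is the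
  Riemann--Liouville integral.
\<close>

subsection \<open>Convolution on Euclidean space\<close>

text \<open>The main obstacle is measure-theoretic. The operators are iterated Lebesgue integrals of
  functions that are only Lebesgue measurable, and the output of the inner operator is known only
  almost everywhere. Therefore functions on the rectangle are exchanged for Borel representatives on
  \<open>lborel\<close>, and the step from operator to convolution accepts a function given up to a
  null set, so that it can be used twice. The kernels themselves convolve at every point;
  exceptional sets enter only with the function acted on. Exchanging series and integrals rests on
  one growth fact: along an arithmetic progression \<open>a + U * r\<close> the reciprocal Gamma
  function beats every geometric sequence, whereas the coefficients grow at most
  geometrically.\<close>

lemma lborel_integrable_translate:
  fixes f :: "'a::euclidean_space \<Rightarrow> 'b::{banach, second_countable_topology}"
  assumes "integrable lborel f"
  shows "integrable lborel (\<lambda>u. f (u - z))"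
  using assms by (subst (asm) lborel_distr_plus[symmetric, of "-z"]) (drule integrable_distr[rotated], auto)

lemma lborel_integral_translate:
  fixes f :: "'a::euclidean_space \<Rightarrow> 'b::{banach, second_countable_topology}"
  assumes "f \<in> borel_measurable borel"
  shows "(\<integral>u. f (u - z) \<partial>lborel) = integral\<^sup>L lborel f"
  using assms integral_distr[of "(+) (- z)" lborel borel f]
  by (simp add: lborel_distr_plus)

definition convolution :: "('a::euclidean_space \<Rightarrow> 'b::{real_normed_field, banach, second_countable_topology})
    \<Rightarrow> ('a \<Rightarrow> 'b) \<Rightarrow> 'a \<Rightarrow> 'b" where
  "convolution f g z = (\<integral>u. f (z - u) * g u \<partial>lborel)"

lemma convolution_measurable [measurable]:
  assumes [measurable]: "f \<in> borel_measurable borel" "g \<in> borel_measurable borel"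
  shows "convolution f g \<in> borel_measurable borel"
proof -
  have "(\<lambda>z. \<integral>u. f (z - u) * g u \<partial>lborel) \<in> borel_measurable lborel"
    by measurable
  then show ?thesis by (simp add: convolution_def[abs_def])
qed

text \<open>By translation invariance the inner integral of the modulus is a constant times
  \<open>norm (g u)\<close>, so the integrand is integrable in both variables; all three claims are
  then read off from Fubini.\<close>

lemma
  fixes f g :: "'a::euclidean_space \<Rightarrow> 'b::{real_normed_field, banach, second_countable_topology}"
  assumes f: "integrable lborel f" and g: "integrable lborel g"
  shows convolution_integrable: "integrable lborel (convolution f g)"
    and convolution_AE_integrable: "AE z in lborel. integrable lborel (\<lambda>u. f (z - u) * g u)"
    and convolution_integral: "integral\<^sup>L lborel (convolution f g) = integral\<^sup>L lborel f * integral\<^sup>L lborel g"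
proof -
  have [measurable]: "f \<in> borel_measurable borel" "g \<in> borel_measurable borel"
    using f g by auto
  have *: "integrable (lborel \<Otimes>\<^sub>M lborel) (\<lambda>(u, z). f (z - u) * g u)"
  proof (rule lborel_pair.Fubini_integrable)
    have "(\<integral>z. norm (f (z - u) * g u) \<partial>lborel) = (\<integral>z. norm (f z) \<partial>lborel) * norm (g u)" for u
      using lborel_integral_translate[of "\<lambda>z. norm (f z)" u] by (simp add: norm_mult)
    then show "integrable lborel (\<lambda>u. \<integral>z. norm (case (u, z) of (u, z) \<Rightarrow> f (z - u) * g u) \<partial>lborel)"
      using g by simp
    show "AE u in lborel. integrable lborel (\<lambda>z. case (u, z) of (u, z) \<Rightarrow> f (z - u) * g u)"
      using lborel_integrable_translate[OF f] by simp
  qed measurable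
  show "integrable lborel (convolution f g)"
    using lborel_pair.integrable_snd[OF *] by (simp add: convolution_def[abs_def])
  show "AE z in lborel. integrable lborel (\<lambda>u. f (z - u) * g u)"
    using lborel_pair.AE_integrable_snd[OF *] by simp
  show "integral\<^sup>L lborel (convolution f g) = integral\<^sup>L lborel f * integral\<^sup>L lborel g"
    using lborel_pair.Fubini_integral[OF *]
    by (simp add: convolution_def[abs_def] lborel_integral_translate)
qed

text \<open>The good points \<open>z\<close> are those where the modulus of \<open>f\<close> can be
  convolved with \<open>G\<close>. There the double integrand is absolutely integrable, the order of
  integration can be swapped, and translating \<open>u\<close> by \<open>v\<close> regroups the
  product.\<close>

lemma convolution_assoc_AE:
  fixes f g h :: "'a::euclidean_space \<Rightarrow> 'b::{real_normed_field, banach, second_countable_topology}"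
  assumes f: "integrable lborel f" and g: "integrable lborel g" and h: "integrable lborel h"
  shows "AE z in lborel. convolution f (convolution g h) z = convolution (convolution f g) h z"
proof -
  have [measurable]: "f \<in> borel_measurable borel" "g \<in> borel_measurable borel" "h \<in> borel_measurable borel"
    using f g h by auto
  define G where "G = convolution (\<lambda>z. norm (g z)) (\<lambda>z. norm (h z))"
  have "integrable lborel G"
    unfolding G_def using g h by (intro convolution_integrable integrable_norm)
  then have "AE z in lborel. integrable lborel (\<lambda>u. norm (f (z - u)) * G u)"
    using f by (intro convolution_AE_integrable integrable_norm)
  then show ?thesis
  proof eventually_elim
    case (elim z)
    have *: "integrable (lborel \<Otimes>\<^sub>M lborel) (\<lambda>(u, v). f (z - u) * (g (u - v) * h v))"
    proof (rule lborel_pair.Fubini_integrable)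
      have "(\<integral>v. norm (f (z - u) * (g (u - v) * h v)) \<partial>lborel) = norm (f (z - u)) * G u" for u
        by (simp add: norm_mult G_def convolution_def)
      then show "integrable lborel (\<lambda>u. \<integral>v. norm (case (u, v) of (u, v) \<Rightarrow> f (z - u) * (g (u - v) * h v)) \<partial>lborel)"
        using elim by simp
      show "AE u in lborel. integrable lborel (\<lambda>v. case (u, v) of (u, v) \<Rightarrow> f (z - u) * (g (u - v) * h v))"
        using convolution_AE_integrable[OF g h] by eventually_elim simp
    qed measurable
    have "convolution f (convolution g h) z = (\<integral>u. \<integral>v. f (z - u) * (g (u - v) * h v) \<partial>lborel \<partial>lborel)"
      by (simp add: convolution_def)
    also have "\<dots> = (\<integral>v. \<integral>u. f (z - u) * (g (u - v) * h v) \<partial>lborel \<partial>lborel)"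
      using lborel_pair.Fubini_integral[OF *] by simp
    also have "\<dots> = (\<integral>v. (\<integral>u. f (z - u) * g (u - v) \<partial>lborel) * h v \<partial>lborel)"
      by (simp flip: mult.assoc)
    also have "(\<lambda>v. \<integral>u. f (z - u) * g (u - v) \<partial>lborel) = (\<lambda>v. convolution f g (z - v))"
    proof
      fix v
      show "(\<integral>u. f (z - u) * g (u - v) \<partial>lborel) = convolution f g (z - v)"
        using lborel_integral_translate[of "\<lambda>w. f (z - v - w) * g w" v] by (simp add: convolution_def)
    qed
    finally show ?case by (simp add: convolution_def)
  qed
qed

lemma
  fixes p q :: "_ \<Rightarrow> 'b::{real_normed_field, banach, second_countable_topology}"
  assumes p: "integrable lborel p" and q: "integrable lborel q"
  shows integrable_lborel_times: "integrable lborel (\<lambda>z. p (fst z) * q (snd z))"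
    and integral_lborel_times:
      "(\<integral>z. p (fst z) * q (snd z) \<partial>lborel) = integral\<^sup>L lborel p * integral\<^sup>L lborel q"
proof -
  have [measurable]: "p \<in> borel_measurable borel" "q \<in> borel_measurable borel"
    using p q by auto
  have *: "integrable (lborel \<Otimes>\<^sub>M lborel) (\<lambda>(x, y). p x * q y)"
    by (rule lborel_pair.Fubini_integrable) (use p q in \<open>auto simp: norm_mult\<close>)
  then show "integrable lborel (\<lambda>z. p (fst z) * q (snd z))"
    by (simp add: lborel_prod case_prod_unfold)
  show "(\<integral>z. p (fst z) * q (snd z) \<partial>lborel) = integral\<^sup>L lborel p * integral\<^sup>L lborel q"
    using lborel_pair.integral_fst[OF *] by (simp add: lborel_prod case_prod_unfold)
qed

section \<open>Termwise integration of unordered series\<close>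

text \<open>An enumeration of \<open>I\<close> reduces the claim to sequences. Domination by
  \<open>B i * H x\<close> makes the integrals absolutely summable, so their unordered sum
  \<open>T\<close> exists, and the limit along the enumeration identifies it.\<close>

lemma has_sum_integral:
  fixes f :: "'i \<Rightarrow> 'a \<Rightarrow> 'b::{banach, second_countable_topology}"
  assumes I: "countable I" "infinite I"
    and f [measurable]: "\<And>i. i \<in> I \<Longrightarrow> f i \<in> borel_measurable M"
    and le: "\<And>i x. i \<in> I \<Longrightarrow> norm (f i x) \<le> B i * H x"
    and B: "B summable_on I" and H: "integrable M H"
    and S: "\<And>x. x \<in> space M \<Longrightarrow> ((\<lambda>i. f i x) has_sum S x) I"
  shows "((\<lambda>i. integral\<^sup>L M (f i)) has_sum integral\<^sup>L M S) I"
proof -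
  let ?g = "from_nat_into I"
  have bij: "bij_betw ?g UNIV I"
    using bij_betw_from_nat_into I by blast
  have gI: "?g n \<in> I" for n
    using from_nat_into[of I] I by auto
  have [measurable]: "f (?g n) \<in> borel_measurable M" for n
    using gI by measurable
  have Bs: "summable (\<lambda>n. B (?g n))"
    using B summable_on_imp_summable summable_on_reindex_bij_betw[OF bij] by blast
  have int: "integrable M (f i)" if "i \<in> I" for i
    by (rule Bochner_Integration.integrable_bound[OF integrable_mult_right[OF H, of "B i"]])
       (use that le in \<open>auto intro!: AE_I2 order_trans[OF le]\<close>)
  have nle: "(\<integral>x. norm (f i x) \<partial>M) \<le> B i * (\<integral>x. H x \<partial>M)" if "i \<in> I" for i
  proof -
    have "(\<integral>x. norm (f i x) \<partial>M) \<le> (\<integral>x. B i * H x \<partial>M)"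
      using that by (intro integral_mono integrable_norm int integrable_mult_right H le)
    then show ?thesis by simp
  qed
  have sn: "summable (\<lambda>n. \<integral>x. norm (f (?g n) x) \<partial>M)"
    by (rule summable_comparison_test'[OF summable_mult2[OF Bs, of "\<integral>x. H x \<partial>M"], of 0])
       (use nle gI in auto)
  have ns: "(\<lambda>i. \<integral>x. norm (f i x) \<partial>M) summable_on I"
    using sn by (subst summable_on_reindex_bij_betw[OF bij, symmetric]) (simp add: summable_on_UNIV_nonneg_real_iff)
  have "(\<lambda>i. integral\<^sup>L M (f i)) summable_on I"
    by (rule abs_summable_summable, rule summable_on_comparison_test[OF ns]) auto
  then obtain T where T: "((\<lambda>i. integral\<^sup>L M (f i)) has_sum T) I"
    using has_sum_infsum by blast
  then have "(\<lambda>n. integral\<^sup>L M (f (?g n))) sums T"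
    using has_sum_imp_sums has_sum_reindex_bij_betw[OF bij] by blast
  moreover have "(\<lambda>n. integral\<^sup>L M (f (?g n))) sums (\<integral>x. (\<Sum>n. f (?g n) x) \<partial>M)"
  proof (rule sums_integral)
    have "summable (\<lambda>n. norm (f (?g n) x))" for x
      by (rule summable_comparison_test'[OF summable_mult2[OF Bs, of "H x"], of 0])
         (use le gI in auto)
    then show "AE x in M. summable (\<lambda>n. norm (f (?g n) x))" by simp
  qed (use int gI sn in auto)
  moreover have "(\<integral>x. (\<Sum>n. f (?g n) x) \<partial>M) = integral\<^sup>L M S"
  proof (rule Bochner_Integration.integral_cong)
    fix x assume "x \<in> space M"
    then have "(\<lambda>n. f (?g n) x) sums S x"
      using has_sum_imp_sums has_sum_reindex_bij_betw[OF bij, of "\<lambda>i. f i x"] S by blast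
    then show "(\<Sum>n. f (?g n) x) = S x" by (rule sums_unique[symmetric])
  qed simp
  ultimately show ?thesis using T sums_unique2 by metis
qed

subsection \<open>Riemann--Liouville kernels and the growth of the reciprocal Gamma function\<close>

text \<open>Extension by 0 to \<open>t \<le> 0\<close> turns the convolution over the whole line
  into an integral over \<open>0 < u < x\<close>; this is how the upper limits of the operator
  arise.\<close>

definition rl_kernel :: "complex \<Rightarrow> real \<Rightarrow> complex" where
  "rl_kernel a t = (if t > 0 then of_real t powr (a - 1) * rGamma a else 0)"

lemma rl_kernel_nonpos [simp]: "t \<le> 0 \<Longrightarrow> rl_kernel a t = 0"
  by (simp add: rl_kernel_def)

lemma rl_kernel_measurable [measurable]: "rl_kernel a \<in> borel_measurable borel"
proof -
  have "(\<lambda>t. indicator {0<..} t *\<^sub>R (complex_of_real t powr (a - 1) * rGamma a)) \<in> borel_measurable borel"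
    by (rule borel_measurable_continuous_on_indicator) (auto intro!: continuous_intros)
  also have "(\<lambda>t. indicator {0<..} t *\<^sub>R (complex_of_real t powr (a - 1) * rGamma a)) = rl_kernel a"
    by (auto simp: rl_kernel_def indicator_def)
  finally show ?thesis .
qed

lemma rGamma_pos_nonzero: "Re a > 0 \<Longrightarrow> rGamma (a::complex) \<noteq> 0"
  by (auto simp: rGamma_eq_zero_iff elim!: nonpos_Ints_cases)

lemma Gamma_pos_nonzero: "Re a > 0 \<Longrightarrow> Gamma (a::complex) \<noteq> 0"
  by (auto simp: Gamma_eq_zero_iff elim!: nonpos_Ints_cases)

lemma rl_kernel_shift:
  assumes "t > 0" "Re a > 0"
  shows "rl_kernel (a + b) t = of_real t powr b * rl_kernel a t * (rGamma (a + b) * Gamma a)"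
proof -
  have "complex_of_real t powr (a + b - 1) = of_real t powr b * of_real t powr (a - 1)"
    by (simp flip: powr_add add: algebra_simps)
  then show ?thesis
    using assms Gamma_pos_nonzero[of a] by (simp add: rl_kernel_def rGamma_inverse_Gamma[of a])
qed

text \<open>The kernel alone is not integrable at infinity. The weight \<open>exp (- t)\<close>
  repairs this, is compatible with convolution because
  \<open>exp (- (x - u)) * exp (- u) = exp (- x)\<close>, and Euler's integral normalises the total
  mass to 1.\<close>

lemma
  assumes "Re a > 0"
  shows integrable_exp_rl_kernel: "integrable lborel (\<lambda>t. of_real (exp (- t)) * rl_kernel a t)"
    and integral_exp_rl_kernel: "(\<integral>t. of_real (exp (- t)) * rl_kernel a t \<partial>lborel) = 1"
proof -
  let ?f = "\<lambda>t. complex_of_real t powr (a - 1) / of_real (exp t)"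
  let ?h = "\<lambda>t. of_real (exp (- t)) * rl_kernel a t"
  have eq: "indicator {0<..} t *\<^sub>R ?f t = Gamma a * ?h t" for t
    using Gamma_pos_nonzero[OF assms]
    by (auto simp: rl_kernel_def indicator_def exp_minus rGamma_inverse_Gamma divide_inverse)
  have abs: "?f absolutely_integrable_on {0<..}"
    by (rule absolutely_integrable_Gamma_integral') fact
  then have "integrable lborel (\<lambda>t. Gamma a * ?h t)"
    unfolding set_integrable_def eq by (subst (asm) integrable_completion) auto
  from integrable_mult_right[OF this, of "inverse (Gamma a)"] show "integrable lborel ?h"
    using Gamma_pos_nonzero[OF assms] by (simp flip: mult.assoc)
  have "(LINT t:{0<..}|lebesgue. ?f t) = Gamma a"
    using set_lebesgue_integral_eq_integral(2)[OF abs] Gamma_integral_complex'[OF assms]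
    by (simp add: integral_unique)
  then have "Gamma a * (\<integral>t. ?h t \<partial>lebesgue) = Gamma a"
    unfolding set_lebesgue_integral_def eq by simp
  moreover have "(\<integral>t. ?h t \<partial>lebesgue) = (\<integral>t. ?h t \<partial>lborel)"
    by (rule integral_completion) measurable
  ultimately show "(\<integral>t. ?h t \<partial>lborel) = 1"
    using Gamma_pos_nonzero[OF assms] by simp
qed

text \<open>Below \<open>L\<close> one has \<open>1 \<le> exp (L - t)\<close>, so the weighted
  kernel dominates and its integrability at 0 is inherited.\<close>

lemma integrable_rl_kernel_truncated:
  assumes "Re a > 0"
  shows "integrable lborel (\<lambda>t. indicator {..<L} t * rl_kernel a t)"
proof (rule Bochner_Integration.integrable_bound)
  show "integrable lborel (\<lambda>t. of_real (exp L) * (of_real (exp (- t)) * rl_kernel a t))"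
    by (intro integrable_mult_right integrable_exp_rl_kernel assms)
  show "AE t in lborel. norm (indicator {..<L} t * rl_kernel a t)
      \<le> norm (of_real (exp L) * (of_real (exp (- t)) * rl_kernel a t))"
  proof (intro AE_I2)
    fix t
    have "norm (indicator {..<L} t * rl_kernel a t) \<le> exp (L + - t) * norm (rl_kernel a t)"
    proof (cases "t < L")
      case True
      then show ?thesis using mult_right_mono[of 1 "exp (L + - t)" "norm (rl_kernel a t)"] by simp
    qed simp
    then show "norm (indicator {..<L} t * rl_kernel a t)
        \<le> norm (of_real (exp L) * (of_real (exp (- t)) * rl_kernel a t))"
      by (simp only: norm_mult norm_of_real exp_add mult.assoc abs_exp_cancel)
  qed
qed measurable

text \<open>
  By homogeneity the convolution is a multiple of the power on the right; multiplying by
  \<open>exp (- x)\<close> and integrating over \<open>x\<close> determines the constant.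
\<close>

lemma rl_kernel_convolution:
  assumes a: "Re a > 0" and b: "Re b > 0"
  shows "convolution (rl_kernel a) (rl_kernel b) = rl_kernel (a + b)"
proof -
  \<comment> \<open>If the integrand at 1 were not integrable, \<open>c\<close> would be 0 by
    convention. \<open>hom\<close> holds in that case too, and the final equation
    \<open>c * Gamma (a + b) = 1\<close> excludes it.\<close>
  define c where "c = convolution (rl_kernel a) (rl_kernel b) 1"
  have hom: "convolution (rl_kernel a) (rl_kernel b) x = c * Gamma (a + b) * rl_kernel (a + b) x" for x
  proof (cases "x > 0")
    case False
    have "rl_kernel a (x - u) * rl_kernel b u = 0" for u
      using False by (cases "u > 0") auto
    then have "convolution (rl_kernel a) (rl_kernel b) x = 0" unfolding convolution_def by (simp only: Bochner_Integration.integral_zero)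
    with False show ?thesis by simp
  next
    case True
    have scale: "rl_kernel a' (x * u) = of_real x powr (a' - 1) * rl_kernel a' u" for a' u
      using True by (auto simp: rl_kernel_def zero_less_mult_iff powr_times_real)
    \<comment> \<open>Replacing \<open>u\<close> by \<open>x * u\<close> pulls the powers
      \<open>a - 1\<close> and \<open>b - 1\<close> of \<open>x\<close> out of the two kernels; the
      Jacobian supplies one more, which gives \<open>a + b - 1\<close>.\<close>
    have "convolution (rl_kernel a) (rl_kernel b) x = \<bar>x\<bar> *\<^sub>R (\<integral>u. rl_kernel a (x - x * u) * rl_kernel b (x * u) \<partial>lborel)"
      using True lborel_integral_real_affine[of x "\<lambda>u. rl_kernel a (x - u) * rl_kernel b u" 0] by (simp add: convolution_def)
    also have "(\<lambda>u. rl_kernel a (x - x * u) * rl_kernel b (x * u))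
        = (\<lambda>u. (of_real x powr (a - 1) * of_real x powr (b - 1)) * (rl_kernel a (1 - u) * rl_kernel b u))"
    proof
      fix u
      have "x - x * u = x * (1 - u)" by (simp add: algebra_simps)
      then show "rl_kernel a (x - x * u) * rl_kernel b (x * u)
          = (of_real x powr (a - 1) * of_real x powr (b - 1)) * (rl_kernel a (1 - u) * rl_kernel b u)"
        by (simp only: scale) (simp add: mult_ac)
    qed
    also have "\<bar>x\<bar> *\<^sub>R (\<integral>u. (of_real x powr (a - 1) * of_real x powr (b - 1)) * (rl_kernel a (1 - u) * rl_kernel b u) \<partial>lborel)
        = c * (of_real x * of_real x powr (a - 1) * of_real x powr (b - 1))"
      using True by (simp add: c_def convolution_def scaleR_conv_of_real)
    also have "of_real x * of_real x powr (a - 1) * of_real x powr (b - 1) = complex_of_real x powr (a + b - 1)"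
      using True by (simp add: powr_diff powr_add)
    finally show ?thesis
      using True a b Gamma_pos_nonzero[of "a + b"]
      by (simp add: rl_kernel_def[of "a + b"] rGamma_inverse_Gamma)
  qed
  let ?e = "\<lambda>a t. of_real (exp (- t)) * rl_kernel a t"
  have "convolution (?e a) (?e b) x = c * Gamma (a + b) * ?e (a + b) x" for x
  proof -
    have "?e a (x - u) * ?e b u = of_real (exp (- x)) * (rl_kernel a (x - u) * rl_kernel b u)" for u
    proof -
      have "complex_of_real (exp (- (x - u))) * of_real (exp (- u)) = of_real (exp (- x))"
        by (simp flip: of_real_mult exp_add)
      then show ?thesis by (metis (no_types, lifting) mult.assoc mult.left_commute)
    qed
    then have "convolution (?e a) (?e b) x = of_real (exp (- x)) * convolution (rl_kernel a) (rl_kernel b) x"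
      by (simp only: convolution_def integral_mult_right_zero)
    then show ?thesis by (simp add: hom)
  qed
  then have "convolution (?e a) (?e b) = (\<lambda>x. c * Gamma (a + b) * ?e (a + b) x)"
    by (rule ext)
  moreover have "integral\<^sup>L lborel (convolution (?e a) (?e b)) = 1"
    using a b by (subst convolution_integral) (simp_all only: integrable_exp_rl_kernel integral_exp_rl_kernel mult_1)
  moreover have "(\<integral>x. c * Gamma (a + b) * ?e (a + b) x \<partial>lborel) = c * Gamma (a + b)"
    using a b integral_exp_rl_kernel[of "a + b"] by simp
  ultimately have "c * Gamma (a + b) = 1"
    by simp
  then show ?thesis using hom by auto
qed

text \<open>A Bochner integral that does not vanish has an integrable integrand.\<close>

lemma rl_kernel_convolution_integrable:
  assumes a: "Re a > 0" and b: "Re b > 0"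
  shows "integrable lborel (\<lambda>u. rl_kernel a (x - u) * rl_kernel b u)"
proof (cases "x > 0")
  case True
  then have "convolution (rl_kernel a) (rl_kernel b) x \<noteq> 0"
    using a b rGamma_pos_nonzero[of "a + b"] by (simp add: rl_kernel_convolution rl_kernel_def)
  then show ?thesis
    unfolding convolution_def using not_integrable_integral_eq by blast
next
  case False
  have "rl_kernel a (x - u) * rl_kernel b u = 0" for u
    using False by (cases "u > 0") auto
  then show ?thesis by (simp only: integrable_zero)
qed

section \<open>Decay of the reciprocal Gamma function in a sector\<close>

text \<open>The part of Euler's integral over \<open>{T..T + 1}\<close> already bounds Gamma from
  below by the minimum of numerator over the maximum of denominator. As \<open>T\<close> is free,
  \<open>rGamma x\<close> decays faster than any prescribed exponential.\<close>

lemma rGamma_real_bound: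
  fixes x T :: real
  assumes "x \<ge> 1" "T > 0"
  shows "rGamma x \<le> exp (T + 1) * T powr (1 - x)"
proof -
  have "((\<lambda>t. T powr (x - 1) / exp (T + 1)) has_integral T powr (x - 1) / exp (T + 1)) {T..T + 1}"
    using has_integral_const_real[of "T powr (x - 1) / exp (T + 1)" T "T + 1"] by simp
  then have "((\<lambda>t. if t \<in> {T..T+1} then T powr (x - 1) / exp (T + 1) else 0)
      has_integral T powr (x - 1) / exp (T + 1)) {0..}"
    using assms by (subst has_integral_restrict) auto
  then have "T powr (x - 1) / exp (T + 1) \<le> Gamma x"
  proof (rule has_integral_le)
    show "((\<lambda>t. t powr (x - 1) / exp t) has_integral Gamma x) {0..}"
      using assms by (intro Gamma_integral_real) auto
    fix t :: real assume "t \<in> {0..}"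
    then show "(if t \<in> {T..T+1} then T powr (x - 1) / exp (T + 1) else 0) \<le> t powr (x - 1) / exp t"
      using assms by (auto intro!: frac_le powr_mono2)
  qed
  moreover have "Gamma x > 0" "T powr (x - 1) > 0" using assms by auto
  ultimately have "inverse (Gamma x) \<le> inverse (T powr (x - 1) / exp (T + 1))"
    by (intro le_imp_inverse_le) auto
  also have "\<dots> = exp (T + 1) * T powr (1 - x)"
    using assms by (simp add: powr_minus[symmetric] divide_inverse)
  finally show ?thesis by (simp add: rGamma_inverse_Gamma)
qed

text \<open>
  Replaces Stirling's formula: in the product formula for \<open>1 / \<Gamma>\<close>, each factor \<open>z + k\<close> exceeds
  \<open>Re z + k\<close> in modulus by at most \<open>exp ((c Re z)\<^sup>2 / (Re z + k)\<^sup>2)\<close>, and these exponents are summable.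
\<close>

lemma norm_rGamma_bound:
  fixes z :: complex
  assumes x: "Re z > 0" and c: "\<bar>Im z\<bar> \<le> c * Re z"
  shows "norm (rGamma z) \<le> exp (c\<^sup>2 * (1 + Re z)) * rGamma (Re z)"
proof -
  define x where "x = Re z"
  have x0: "x > 0" using x by (simp add: x_def)
  \<comment> \<open>Comparison with a telescoping sum; the term \<open>1 / x\<^sup>2\<close> of
    index 0 is kept apart.\<close>
  have sum_le: "(\<Sum>k<Suc n. 1 / (x + real k)\<^sup>2) \<le> 1 / x\<^sup>2 + 1 / x - 1 / (x + real n)" for n
  proof (induction n)
    case (Suc n)
    have "1 / (x + real (Suc n))\<^sup>2 \<le> 1 / ((x + real n) * (x + real (Suc n)))"
      using x0 by (intro divide_left_mono) (auto simp: power2_eq_square intro!: mult_mono)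
    also have "\<dots> = 1 / (x + real n) - 1 / (x + real (Suc n))"
      using x0 by (simp add: divide_simps)
    finally show ?case using Suc by simp
  qed simp
  have factor: "norm (z + of_nat k) \<le> (x + real k) * exp ((c * x)\<^sup>2 * (1 / (x + real k)\<^sup>2))" for k
  proof -
    let ?d = "x + real k"
    have d: "?d > 0" using x0 by simp
    have "(norm (z + of_nat k))\<^sup>2 = ?d\<^sup>2 + (Im z)\<^sup>2"
      by (simp add: cmod_power2 x_def)
    also have "\<dots> \<le> ?d\<^sup>2 + (c * x)\<^sup>2"
      using c by (simp add: x_def abs_le_square_iff[symmetric])
    also have "\<dots> = ?d\<^sup>2 * (1 + (c * x)\<^sup>2 * (1 / ?d\<^sup>2))"
      using d by (simp add: field_simps)
    also have "\<dots> \<le> ?d\<^sup>2 * exp ((c * x)\<^sup>2 * (1 / ?d\<^sup>2))"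
      by (intro mult_left_mono exp_ge_add_one_self) auto
    \<comment> \<open>Squaring the exponential wastes a factor 2 in the exponent, but makes both
      sides squares.\<close>
    also have "\<dots> \<le> ?d\<^sup>2 * (exp ((c * x)\<^sup>2 * (1 / ?d\<^sup>2)))\<^sup>2"
      by (intro mult_left_mono) (auto simp: power2_eq_square)
    finally have "(norm (z + of_nat k))\<^sup>2 \<le> (?d * exp ((c * x)\<^sup>2 * (1 / ?d\<^sup>2)))\<^sup>2"
      by (simp add: power_mult_distrib)
    then show ?thesis
      by (rule power2_le_imp_le) (use d in auto)
  qed
  have poch: "norm (pochhammer z (Suc n)) \<le> exp (c\<^sup>2 * (1 + x)) * pochhammer x (Suc n)" for n
  proof -
    have "norm (pochhammer z (Suc n)) = (\<Prod>k<Suc n. norm (z + of_nat k))"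
      by (simp add: pochhammer_prod prod_norm lessThan_atLeast0 del: prod.lessThan_Suc prod.op_ivl_Suc)
    also have "\<dots> \<le> (\<Prod>k<Suc n. (x + real k) * exp ((c * x)\<^sup>2 * (1 / (x + real k)\<^sup>2)))"
      by (intro prod_mono conjI factor) auto
    also have "\<dots> = pochhammer x (Suc n) * exp ((c * x)\<^sup>2 * (\<Sum>k<Suc n. 1 / (x + real k)\<^sup>2))"
      by (simp add: pochhammer_prod prod.distrib exp_sum sum_distrib_left lessThan_atLeast0
          del: prod.lessThan_Suc prod.op_ivl_Suc sum.lessThan_Suc sum.op_ivl_Suc)
    also have "\<dots> \<le> pochhammer x (Suc n) * exp (c\<^sup>2 * (1 + x))"
    proof -
      have "(c * x)\<^sup>2 * (\<Sum>k<Suc n. 1 / (x + real k)\<^sup>2) \<le> (c * x)\<^sup>2 * (1 / x\<^sup>2 + 1 / x)"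
      proof (intro mult_left_mono order_trans[OF sum_le])
        show "1 / x\<^sup>2 + 1 / x - 1 / (x + real n) \<le> 1 / x\<^sup>2 + 1 / x" using x0 by simp
      qed auto
      \<comment> \<open>The exponent is only linear in \<open>Re z\<close>, so a suitable
        \<open>T\<close> in \<open>rGamma_real_bound\<close> can absorb it.\<close>
      also have "\<dots> = c\<^sup>2 * (1 + x)"
        using x0 by (simp add: field_simps power2_eq_square)
      finally show ?thesis
        using x0 by (intro mult_left_mono) (auto intro!: less_imp_le pochhammer_pos)
    qed
    finally show ?thesis by (simp add: mult.commute)
  qed
  have "norm (rGamma_series z n) \<le> exp (c\<^sup>2 * (1 + x)) * rGamma_series x n" for n
  proof -
    have "norm (exp (z * of_real (ln (real n)))) = exp (x * ln (real n))"
      by (simp add: x_def)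
    then have "norm (rGamma_series z n) = norm (pochhammer z (Suc n)) / (fact n * exp (x * ln (real n)))"
      unfolding rGamma_series_def norm_divide norm_mult by simp
    also have "\<dots> \<le> exp (c\<^sup>2 * (1 + x)) * pochhammer x (Suc n) / (fact n * exp (x * ln (real n)))"
      by (intro divide_right_mono poch) auto
    finally show ?thesis by (simp add: rGamma_series_def)
  qed
  moreover have "(\<lambda>n. norm (rGamma_series z n)) \<longlonglongrightarrow> norm (rGamma z)"
    by (intro tendsto_intros)
  moreover have "(\<lambda>n. exp (c\<^sup>2 * (1 + x)) * rGamma_series x n) \<longlonglongrightarrow> exp (c\<^sup>2 * (1 + x)) * rGamma x"
    by (intro tendsto_intros)
  ultimately show ?thesis
    using LIMSEQ_le unfolding x_def[symmetric] by blast
qed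

text \<open>All points \<open>a + U * r\<close> lie in one sector, so the two preceding bounds
  combine. Up to a constant they give \<open>exp (c\<^sup>2 * x) * T powr (- x)\<close> at real part
  \<open>x\<close>, and \<open>T\<close> can be adapted to \<open>K\<close>.\<close>

lemma summable_rGamma_powers:
  fixes a U :: complex and K :: real
  assumes a: "Re a > 0" and U: "Re U > 0" and K: "K \<ge> 0"
  shows "summable (\<lambda>r. norm (rGamma (a + U * of_nat r)) * K ^ r)"
proof -
  define \<alpha> u where "\<alpha> = Re a" and "u = Re U"
  define c where "c = \<bar>Im a\<bar> / \<alpha> + \<bar>Im U\<bar> / u"
  \<comment> \<open>With \<open>T = exp (c\<^sup>2 + p)\<close> the growth
    \<open>exp (c\<^sup>2 * x)\<close> cancels and \<open>exp (- p * x)\<close> is left. Since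
    \<open>p * u = ln (2 * K + 2)\<close>, each step in \<open>r\<close> gains the factor
    \<open>1 / (2 * K + 2)\<close>, and the ratio \<open>K / (2 * K + 2)\<close> is below 1 also for
    \<open>K = 0\<close>.\<close>
  define p where "p = ln (2 * K + 2) / u"
  define T where "T = exp (c\<^sup>2 + p)"
  define M where "M = exp (c\<^sup>2) * exp (T + 1) * T * exp (- p * \<alpha>)"
  have pos: "\<alpha> > 0" "u > 0" "T > 0" using a U by (auto simp: \<alpha>_def u_def T_def)
  have c0: "\<bar>Im a\<bar> \<le> c * \<alpha>" "\<bar>Im U\<bar> \<le> c * u"
    using pos by (auto simp: c_def field_simps)
  have bound: "norm (rGamma (a + U * of_nat r)) * K ^ r \<le> M * (K / (2 * K + 2)) ^ r"
    if r: "\<alpha> + u * real r \<ge> 1" for r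
  proof -
    let ?z = "a + U * of_nat r"
    let ?x = "\<alpha> + u * real r"
    have Re: "Re ?z = ?x" by (simp add: \<alpha>_def u_def)
    have "\<bar>Im ?z\<bar> \<le> \<bar>Im a\<bar> + \<bar>Im U\<bar> * real r"
      using abs_triangle_ineq[of "Im a" "Im U * real r"] by (simp add: abs_mult)
    also have "\<dots> \<le> c * \<alpha> + (c * u) * real r"
      by (intro add_mono mult_right_mono c0) auto
    also have "\<dots> = c * Re ?z" unfolding Re by (simp add: algebra_simps)
    finally have "norm (rGamma ?z) \<le> exp (c\<^sup>2 * (1 + ?x)) * rGamma ?x"
      using norm_rGamma_bound[of ?z c] r Re by simp
    also have "\<dots> \<le> exp (c\<^sup>2 * (1 + ?x)) * (exp (T + 1) * T powr (1 - ?x))"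
      using r pos by (intro mult_left_mono rGamma_real_bound) auto
    also have "\<dots> = M * exp (real r * (- p * u))"
    proof -
      have "T powr (1 - ?x) = exp ((1 - ?x) * (c\<^sup>2 + p))"
        by (simp add: powr_def T_def)
      moreover have "M = exp (c\<^sup>2 + (T + 1) + (c\<^sup>2 + p) + (- p * \<alpha>))"
        by (simp only: M_def exp_add T_def)
      ultimately show ?thesis
        by (simp only: exp_add[symmetric]) (simp add: algebra_simps)
    qed
    also have "exp (real r * (- p * u)) = (1 / (2 * K + 2)) ^ r"
    proof -
      have "exp (- p * u) = 1 / (2 * K + 2)"
        using pos K by (simp add: p_def exp_minus inverse_eq_divide)
      then show ?thesis by (simp only: exp_of_nat_mult)
    qed
    finally have "norm (rGamma ?z) * K ^ r \<le> M * (1 / (2 * K + 2)) ^ r * K ^ r"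
      using K by (intro mult_right_mono) auto
    then show ?thesis by (simp add: power_divide)
  qed
  \<comment> \<open>\<open>rGamma_real_bound\<close> requires real part at least 1, which holds for
    all large \<open>r\<close>.\<close>
  obtain r0 where r0: "1 \<le> \<alpha> + u * real r" if "r \<ge> r0" for r
  proof -
    obtain n where n: "1 < real n * u" using pos reals_Archimedean3 by blast
    show ?thesis
    proof (rule that)
      fix r assume "n \<le> r"
      then have "real n * u \<le> real r * u" using pos by (intro mult_right_mono) auto
      then show "1 \<le> \<alpha> + u * real r" using n pos unfolding mult.commute[of u] by linarith
    qed
  qed
  show ?thesis
  proof (rule summable_comparison_test')
    show "summable (\<lambda>r. M * (K / (2 * K + 2)) ^ r)"
      using K by (intro summable_mult summable_geometric) (simp add: field_simps)
    show "norm (norm (rGamma (a + U * of_nat r)) * K ^ r) \<le> M * (K / (2 * K + 2)) ^ r" if "r \<ge> r0" for r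
      using bound[OF r0[OF that]] K by simp
  qed
qed

subsection \<open>Double series of Riemann--Liouville kernels\<close>

lemma summable_on_times:
  fixes f :: "'i \<Rightarrow> real" and g :: "'j \<Rightarrow> real"
  assumes f: "f summable_on A" and g: "g summable_on B"
    and nonneg: "\<And>i. f i \<ge> 0" "\<And>j. g j \<ge> 0"
  shows "(\<lambda>(i, j). f i * g j) summable_on A \<times> B"
  by (rule summable_on_SigmaI[where g = "\<lambda>i. f i * infsum g B"])
     (use assms in \<open>auto intro!: has_sum_cmult_right summable_on_cmult_left\<close>)

lemma has_sum_times:
  fixes f g :: "_ \<Rightarrow> complex"
  assumes f: "(f has_sum S) A" and g: "(g has_sum T) B"
    and abs: "(\<lambda>i. norm (f i)) summable_on A" "(\<lambda>j. norm (g j)) summable_on B"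
  shows "((\<lambda>(i, j). f i * g j) has_sum S * T) (A \<times> B)"
proof (rule has_sum_SigmaI[where g = "\<lambda>i. f i * T"])
  have "(\<lambda>(i, j). norm (f i) * norm (g j)) summable_on A \<times> B"
    by (rule summable_on_times) (use abs in auto)
  then show "(\<lambda>(i, j). f i * g j) summable_on A \<times> B"
    by (intro abs_summable_summable[where f = "\<lambda>(i, j). f i * g j"]) (simp add: case_prod_unfold norm_mult)
  show "((\<lambda>j. case (i, j) of (i, j) \<Rightarrow> f i * g j) has_sum f i * T) B" for i
    unfolding prod.case by (rule has_sum_cmult_right[OF g])
  show "((\<lambda>i. f i * T) has_sum S * T) A"
    by (rule has_sum_cmult_left[OF f])
qed

text \<open>The bridge between the iterated \<open>suminf\<close> in the definition of the
  Mittag-Leffler function and unordered sums over pairs, which can be rearranged.\<close>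

lemma suminf_suminf_eq:
  fixes f :: "nat \<times> nat \<Rightarrow> complex"
  assumes "(f has_sum S) UNIV"
  shows "(\<Sum>s. \<Sum>r. f (s, r)) = S"
proof -
  have summ: "(\<lambda>(s, r). f (s, r)) summable_on UNIV \<times> UNIV"
    using assms by (auto simp: summable_on_def)
  have inner: "((\<lambda>r. f (s, r)) has_sum infsum (\<lambda>r. f (s, r)) UNIV) UNIV" for s
    by (rule has_sum_infsum, rule summable_on_SigmaD1[OF summ]) simp
  have "((\<lambda>s. infsum (\<lambda>r. f (s, r)) UNIV) has_sum S) UNIV"
    by (rule has_sum_SigmaD[where f = f and B = "\<lambda>_. UNIV"]) (simp_all add: assms inner)
  then have "(\<lambda>s. infsum (\<lambda>r. f (s, r)) UNIV) sums S"
    by (rule has_sum_imp_sums)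
  moreover have "(\<Sum>r. f (s, r)) = infsum (\<lambda>r. f (s, r)) UNIV" for s
    using has_sum_imp_sums[OF inner] by (rule sums_unique[symmetric])
  ultimately show ?thesis
    by (simp only: sums_unique[symmetric])
qed

text \<open>Index pairs are grouped by their sum. Each group is a finite box, and \<open>G\<close>
  is constant on it.\<close>

lemma has_sum_Cauchy_product2:
  fixes a b :: "nat \<times> nat \<Rightarrow> complex" and G :: "nat \<Rightarrow> nat \<Rightarrow> complex"
  assumes "((\<lambda>((s, r), (s', r')). a (s, r) * b (s', r') * G (s + s') (r + r')) has_sum S) UNIV"
  shows "((\<lambda>(s, r). (\<Sum>s'\<le>s. \<Sum>r'\<le>r. a (s', r') * b (s - s', r - r')) * G s r) has_sum S) UNIV"
proof -
  let ?B = "\<lambda>(s, r). {..s::nat} \<times> {..r::nat}"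
  let ?g = "\<lambda>((s, r), (s', r')). ((s', r'), (s - s', r - r'))"
  let ?f = "\<lambda>((s, r), (s', r')). a (s, r) * b (s', r') * G (s + s') (r + r')"
  \<comment> \<open>Truncated subtraction is harmless: on \<open>Sigma UNIV ?B\<close> the first
    summand never exceeds the total.\<close>
  have "bij_betw ?g (Sigma UNIV ?B) UNIV"
    by (rule bij_betw_byWitness[where f' = "\<lambda>((s, r), (s', r')). ((s + s', r + r'), (s, r))"]) auto
  then have "((\<lambda>x. ?f (?g x)) has_sum S) (Sigma UNIV ?B)"
    using assms has_sum_reindex_bij_betw by blast
  then have *: "((\<lambda>p. \<Sum>q\<in>?B p. ?f (?g (p, q))) has_sum S) UNIV"
    by (rule has_sum_SigmaD) (auto intro!: has_sum_finite)
  have "(\<Sum>q\<in>?B p. ?f (?g (p, q)))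
      = (case p of (s, r) \<Rightarrow> (\<Sum>s'\<le>s. \<Sum>r'\<le>r. a (s', r') * b (s - s', r - r')) * G s r)" for p
    by (cases p) (auto simp: sum.cartesian_product sum_distrib_right case_prod_unfold intro!: sum.cong)
  with * show ?thesis by simp
qed

definition rl_term :: "complex \<Rightarrow> complex \<Rightarrow> complex \<Rightarrow> nat \<times> nat \<Rightarrow> real \<times> real \<Rightarrow> complex" where
  "rl_term \<kappa> \<rho> U i z = rl_kernel (\<kappa> + of_nat (fst i)) (fst z) * rl_kernel (\<rho> + U * of_nat (snd i)) (snd z)"

text \<open>
  \<open>rl_bound\<close> bounds the quotient of the \<open>i\<close>-th term by the term of index \<open>(0, 0)\<close> on \<open>{..L} \<times> {..M}\<close>,
  see \<open>norm_rl_term_le\<close>.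
\<close>

definition rl_bound :: "complex \<Rightarrow> complex \<Rightarrow> complex \<Rightarrow> real \<Rightarrow> real \<Rightarrow> nat \<times> nat \<Rightarrow> real" where
  "rl_bound \<kappa> \<rho> U L M i =
     (norm (Gamma \<kappa>) * (norm (rGamma (\<kappa> + of_nat (fst i))) * L ^ fst i)) *
     (norm (Gamma \<rho>) * (norm (rGamma (\<rho> + U * of_nat (snd i))) * (M powr Re U) ^ snd i))"

definition rl_series ::
    "complex \<Rightarrow> complex \<Rightarrow> complex \<Rightarrow> (nat \<times> nat \<Rightarrow> complex) \<Rightarrow> real \<times> real \<Rightarrow> complex" where
  "rl_series \<kappa> \<rho> U c z = (\<Sum>s. \<Sum>r. c (s, r) * rl_term \<kappa> \<rho> U (s, r) z)"

text \<open>Convergence of the dominating series on boxes of every size controls the series at a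
  point, termwise integration in a convolution, and integrability of the truncated kernel.\<close>

definition rl_admissible ::
    "complex \<Rightarrow> complex \<Rightarrow> complex \<Rightarrow> (nat \<times> nat \<Rightarrow> complex) \<Rightarrow> bool" where
  "rl_admissible \<kappa> \<rho> U c \<longleftrightarrow>
     (\<forall>L\<ge>0. \<forall>M. (\<lambda>i. norm (c i) * rl_bound \<kappa> \<rho> U L M i) summable_on UNIV)"

lemma rl_term_measurable [measurable]: "rl_term \<kappa> \<rho> U i \<in> borel_measurable borel"
  unfolding rl_term_def[abs_def] borel_prod[symmetric] by measurable

lemma rl_series_measurable [measurable]: "rl_series \<kappa> \<rho> U c \<in> borel_measurable borel"
  unfolding rl_series_def by measurable

lemma rl_term_eq_0: "fst z \<le> 0 \<or> snd z \<le> 0 \<Longrightarrow> rl_term \<kappa> \<rho> U i z = 0"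
  by (auto simp: rl_term_def)

lemma rl_series_eq_0: "fst z \<le> 0 \<or> snd z \<le> 0 \<Longrightarrow> rl_series \<kappa> \<rho> U c z = 0"
  by (simp add: rl_series_def rl_term_eq_0)

lemma norm_rl_kernel_shift_le:
  assumes "t \<le> L" "L \<ge> 0" "Re a > 0" "Re b \<ge> 0"
  shows "norm (rl_kernel (a + b * of_nat k) t)
    \<le> norm (Gamma a) * (norm (rGamma (a + b * of_nat k)) * (L powr Re b) ^ k) * norm (rl_kernel a t)"
proof (cases "t > 0")
  case True
  have "norm (complex_of_real t powr (b * of_nat k)) = (t powr Re b) ^ k"
    using True by (simp add: norm_powr_real_powr powr_powr[symmetric] powr_realpow)
  moreover have "(t powr Re b) ^ k \<le> (L powr Re b) ^ k"
    using True assms by (intro power_mono powr_mono2) auto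
  ultimately show ?thesis
    using True assms by (simp add: rl_kernel_shift norm_mult mult_left_mono mult_right_mono mult_ac)
qed simp

lemma norm_rl_term_le:
  assumes "fst z \<le> L" "snd z \<le> M" "Re \<kappa> > 0" "Re \<rho> > 0" "Re U > 0" "0 \<le> L" "0 \<le> M"
  shows "norm (rl_term \<kappa> \<rho> U i z) \<le> rl_bound \<kappa> \<rho> U L M i * norm (rl_kernel \<kappa> (fst z) * rl_kernel \<rho> (snd z))"
proof -
  have "norm (rl_kernel (\<kappa> + of_nat (fst i)) (fst z))
      \<le> norm (Gamma \<kappa>) * (norm (rGamma (\<kappa> + of_nat (fst i))) * L ^ fst i) * norm (rl_kernel \<kappa> (fst z))"
    using norm_rl_kernel_shift_le[of "fst z" L \<kappa> 1 "fst i"] assms by simp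
  moreover have "norm (rl_kernel (\<rho> + U * of_nat (snd i)) (snd z))
      \<le> norm (Gamma \<rho>) * (norm (rGamma (\<rho> + U * of_nat (snd i))) * (M powr Re U) ^ snd i) * norm (rl_kernel \<rho> (snd z))"
    using norm_rl_kernel_shift_le[of "snd z" M \<rho> U "snd i"] assms by simp
  ultimately have "norm (rl_term \<kappa> \<rho> U i z) \<le>
      (norm (Gamma \<kappa>) * (norm (rGamma (\<kappa> + of_nat (fst i))) * L ^ fst i) * norm (rl_kernel \<kappa> (fst z))) *
      (norm (Gamma \<rho>) * (norm (rGamma (\<rho> + U * of_nat (snd i))) * (M powr Re U) ^ snd i) * norm (rl_kernel \<rho> (snd z)))"
    unfolding rl_term_def norm_mult using assms by (intro mult_mono) auto
  then show ?thesis by (simp add: rl_bound_def norm_mult mult_ac)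
qed

lemma
  assumes adm: "rl_admissible \<kappa> \<rho> U c" and re: "Re \<kappa> > 0" "Re \<rho> > 0" "Re U > 0"
  shows rl_series_abs_summable: "(\<lambda>i. norm (c i * rl_term \<kappa> \<rho> U i z)) summable_on UNIV"
    and rl_series_has_sum: "((\<lambda>i. c i * rl_term \<kappa> \<rho> U i z) has_sum rl_series \<kappa> \<rho> U c z) UNIV"
proof -
  let ?L = "max 0 (fst z)" and ?M = "max 0 (snd z)"
  let ?H = "norm (rl_kernel \<kappa> (fst z) * rl_kernel \<rho> (snd z))"
  have "(\<lambda>i. norm (c i) * rl_bound \<kappa> \<rho> U ?L ?M i * ?H) summable_on UNIV"
    using adm by (intro summable_on_cmult_left) (auto simp: rl_admissible_def)
  then show *: "(\<lambda>i. norm (c i * rl_term \<kappa> \<rho> U i z)) summable_on UNIV"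
  proof (rule summable_on_comparison_test)
    fix i
    show "norm (c i * rl_term \<kappa> \<rho> U i z) \<le> norm (c i) * rl_bound \<kappa> \<rho> U ?L ?M i * ?H"
      using norm_rl_term_le[of z ?L ?M \<kappa> \<rho> U i] re
      by (simp only: norm_mult[of "c i"] mult.assoc) (intro mult_left_mono, auto)
  qed auto
  then have "((\<lambda>i. c i * rl_term \<kappa> \<rho> U i z) has_sum infsum (\<lambda>i. c i * rl_term \<kappa> \<rho> U i z) UNIV) UNIV"
    by (rule has_sum_infsum[OF abs_summable_summable])
  moreover from suminf_suminf_eq[OF this]
  have "rl_series \<kappa> \<rho> U c z = infsum (\<lambda>i. c i * rl_term \<kappa> \<rho> U i z) UNIV"
    unfolding rl_series_def .
  ultimately show "((\<lambda>i. c i * rl_term \<kappa> \<rho> U i z) has_sum rl_series \<kappa> \<rho> U c z) UNIV"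
    by simp
qed

text \<open>Fubini splits the integral into two one-dimensional convolutions. The result is again an
  \<open>rl_term\<close> because both factors carry the same \<open>U\<close>: the orders
  \<open>U * r\<close> and \<open>U * r'\<close> add up to \<open>U * (r + r')\<close>.\<close>

lemma rl_term_convolution:
  assumes re: "Re \<kappa> > 0" "Re \<rho> > 0" "Re \<sigma> > 0" "Re \<eta> > 0" "Re U > 0"
  shows "convolution (rl_term \<kappa> \<rho> U (s, r)) (rl_term \<sigma> \<eta> U (s', r')) z
    = rl_term (\<kappa> + \<sigma>) (\<rho> + \<eta>) U (s + s', r + r') z"
proof -
  have pos: "Re (\<kappa> + of_nat s) > 0" "Re (\<sigma> + of_nat s') > 0"
    "Re (\<rho> + U * of_nat r) > 0" "Re (\<eta> + U * of_nat r') > 0"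
    using re by (auto intro: add_pos_nonneg)
  have "convolution (rl_term \<kappa> \<rho> U (s, r)) (rl_term \<sigma> \<eta> U (s', r')) z
    = (\<integral>u. (rl_kernel (\<kappa> + of_nat s) (fst z - fst u) * rl_kernel (\<sigma> + of_nat s') (fst u)) *
           (rl_kernel (\<rho> + U * of_nat r) (snd z - snd u) * rl_kernel (\<eta> + U * of_nat r') (snd u)) \<partial>lborel)"
    by (simp add: convolution_def rl_term_def mult_ac)
  also have "\<dots> = convolution (rl_kernel (\<kappa> + of_nat s)) (rl_kernel (\<sigma> + of_nat s')) (fst z) *
      convolution (rl_kernel (\<rho> + U * of_nat r)) (rl_kernel (\<eta> + U * of_nat r')) (snd z)"
    unfolding convolution_def by (rule integral_lborel_times) (intro rl_kernel_convolution_integrable pos)+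
  finally show ?thesis
    using pos by (simp add: rl_kernel_convolution rl_term_def algebra_simps)
qed

text \<open>This holds at every point: the convolution integrand of the leading kernels is
  integrable for each \<open>z\<close> and dominates all terms up to summable constants. After
  integration a term depends on the index sums only, so the Cauchy product applies.\<close>

lemma rl_series_convolution:
  assumes re: "Re \<kappa> > 0" "Re \<rho> > 0" "Re \<sigma> > 0" "Re \<eta> > 0" "Re U > 0"
    and c: "rl_admissible \<kappa> \<rho> U c" and d: "rl_admissible \<sigma> \<eta> U d"
    and e: "\<And>s r. e (s, r) = (\<Sum>s'\<le>s. \<Sum>r'\<le>r. c (s', r') * d (s - s', r - r'))"
  shows "convolution (rl_series \<kappa> \<rho> U c) (rl_series \<sigma> \<eta> U d) z = rl_series (\<kappa> + \<sigma>) (\<rho> + \<eta>) U e z"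
proof (cases "fst z > 0 \<and> snd z > 0")
  case False
  have "rl_series \<kappa> \<rho> U c (z - u) * rl_series \<sigma> \<eta> U d u = 0" for u
  proof (cases "fst u \<le> 0 \<or> snd u \<le> 0")
    case False
    then have "fst (z - u) \<le> 0 \<or> snd (z - u) \<le> 0"
      using \<open>\<not> (fst z > 0 \<and> snd z > 0)\<close> by auto
    then show ?thesis by (simp only: rl_series_eq_0 mult_zero_left)
  qed (simp add: rl_series_eq_0)
  then have "convolution (rl_series \<kappa> \<rho> U c) (rl_series \<sigma> \<eta> U d) z = 0"
    unfolding convolution_def by (simp only: Bochner_Integration.integral_zero)
  moreover have "fst z \<le> 0 \<or> snd z \<le> 0" using False by auto
  ultimately show ?thesis by (simp add: rl_series_eq_0)
next
  case True
  \<comment> \<open>The integrand lives on \<open>0 < u < z\<close> componentwise, where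
    \<open>u\<close> and \<open>z - u\<close> both stay below \<open>z\<close>; one box of size
    \<open>z\<close> therefore serves both series.\<close>
  let ?b = "\<lambda>i. norm (c i) * rl_bound \<kappa> \<rho> U (fst z) (snd z) i"
  let ?b' = "\<lambda>j. norm (d j) * rl_bound \<sigma> \<eta> U (fst z) (snd z) j"
  let ?f = "\<lambda>(i, j) u. (c i * rl_term \<kappa> \<rho> U i (z - u)) * (d j * rl_term \<sigma> \<eta> U j u)"
  let ?w = "\<lambda>u. rl_kernel \<kappa> (fst z - fst u) * rl_kernel \<rho> (snd z - snd u)"
  let ?w' = "\<lambda>u. rl_kernel \<sigma> (fst u) * rl_kernel \<eta> (snd u)"
  have b0: "?b i \<ge> 0" "?b' j \<ge> 0" for i j
    using True by (auto simp: rl_bound_def)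
  have hs: "((\<lambda>p. integral\<^sup>L lborel (?f p)) has_sum
      (\<integral>u. rl_series \<kappa> \<rho> U c (z - u) * rl_series \<sigma> \<eta> U d u \<partial>lborel)) (UNIV \<times> UNIV)"
  proof (rule has_sum_integral[where B = "\<lambda>(i, j). ?b i * ?b' j" and H = "\<lambda>u. norm (?w u * ?w' u)"])
    show "infinite (UNIV \<times> UNIV :: ((nat \<times> nat) \<times> nat \<times> nat) set)"
      by (simp add: finite_prod)
    show "?f p \<in> borel_measurable lborel" for p
      by (cases p) simp
    show "(\<lambda>(i, j). ?b i * ?b' j) summable_on UNIV \<times> UNIV"
      by (rule summable_on_times) (use c d True b0 in \<open>auto simp: rl_admissible_def\<close>)
    have "integrable lborel (\<lambda>u. (rl_kernel \<kappa> (fst z - fst u) * rl_kernel \<sigma> (fst u)) * (rl_kernel \<rho> (snd z - snd u) * rl_kernel \<eta> (snd u)))"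
      using integrable_lborel_times[OF rl_kernel_convolution_integrable rl_kernel_convolution_integrable] re by blast
    then show "integrable lborel (\<lambda>u. norm (?w u * ?w' u))"
      by (intro integrable_norm) (simp add: mult_ac)
    show "((\<lambda>p. ?f p u) has_sum rl_series \<kappa> \<rho> U c (z - u) * rl_series \<sigma> \<eta> U d u) (UNIV \<times> UNIV)" for u
      using has_sum_times[OF rl_series_has_sum[OF c re(1,2,5), of "z - u"] rl_series_has_sum[OF d re(3,4,5), of u]
          rl_series_abs_summable[OF c re(1,2,5), of "z - u"] rl_series_abs_summable[OF d re(3,4,5), of u]]
      by (simp add: case_prod_unfold)
    show "norm (?f p u) \<le> (case p of (i, j) \<Rightarrow> ?b i * ?b' j) * norm (?w u * ?w' u)" for p u
    proof -
      obtain i j where Pair: "p = (i, j)" by (cases p)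
      show ?thesis
      proof (cases "0 < fst u \<and> 0 < snd u \<and> fst u < fst z \<and> snd u < snd z")
        case True
        have "norm (c i * rl_term \<kappa> \<rho> U i (z - u)) \<le> ?b i * norm (?w u)"
          using norm_rl_term_le[of "z - u" "fst z" "snd z" \<kappa> \<rho> U i] re True
          by (simp only: norm_mult[of "c i"] mult.assoc) (intro mult_left_mono, auto)
        moreover have "norm (d j * rl_term \<sigma> \<eta> U j u) \<le> ?b' j * norm (?w' u)"
          using norm_rl_term_le[of u "fst z" "snd z" \<sigma> \<eta> U j] re True
          by (simp only: norm_mult[of "d j"] mult.assoc) (intro mult_left_mono, auto)
        ultimately have "norm (c i * rl_term \<kappa> \<rho> U i (z - u)) * norm (d j * rl_term \<sigma> \<eta> U j u)
            \<le> (?b i * norm (?w u)) * (?b' j * norm (?w' u))"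
          by (intro mult_mono) (simp_all only: mult_nonneg_nonneg b0 norm_ge_zero)
        then show ?thesis
          unfolding Pair prod.case norm_mult[of "c i * _"] norm_mult[of "?w u"] by (simp only: mult_ac)
      next
        case False
        then have "(fst u \<le> 0 \<or> snd u \<le> 0) \<or> (fst (z - u) \<le> 0 \<or> snd (z - u) \<le> 0)" by auto
        then have "rl_term \<kappa> \<rho> U i (z - u) = 0 \<or> rl_term \<sigma> \<eta> U j u = 0"
          using rl_term_eq_0 by blast
        then have "norm (?f p u) = 0"
          by (auto simp: Pair)
        then show ?thesis
          by (simp only: Pair prod.case mult_nonneg_nonneg b0 norm_ge_zero)
      qed
    qed
  qed auto
  have int_term: "(\<integral>u. (c (s, r) * rl_term \<kappa> \<rho> U (s, r) (z - u)) * (d (s', r') * rl_term \<sigma> \<eta> U (s', r') u) \<partial>lborel)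
      = c (s, r) * d (s', r') * rl_term (\<kappa> + \<sigma>) (\<rho> + \<eta>) U (s + s', r + r') z" for s r s' r'
  proof -
    have "(c (s, r) * rl_term \<kappa> \<rho> U (s, r) (z - u)) * (d (s', r') * rl_term \<sigma> \<eta> U (s', r') u)
        = c (s, r) * d (s', r') * (rl_term \<kappa> \<rho> U (s, r) (z - u) * rl_term \<sigma> \<eta> U (s', r') u)" for u
      by (simp only: mult_ac)
    then show ?thesis
      using re by (simp only: integral_mult_right_zero convolution_def[symmetric] rl_term_convolution)
  qed
  have eq: "(\<lambda>p. integral\<^sup>L lborel (?f p))
      = (\<lambda>((s, r), (s', r')). c (s, r) * d (s', r') * rl_term (\<kappa> + \<sigma>) (\<rho> + \<eta>) U (s + s', r + r') z)"
    by (simp only: fun_eq_iff split_paired_All prod.case int_term) simp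
  have "((\<lambda>((s, r), (s', r')). c (s, r) * d (s', r') * rl_term (\<kappa> + \<sigma>) (\<rho> + \<eta>) U (s + s', r + r') z)
      has_sum convolution (rl_series \<kappa> \<rho> U c) (rl_series \<sigma> \<eta> U d) z) UNIV"
    using hs unfolding eq UNIV_Times_UNIV convolution_def .
  from has_sum_Cauchy_product2[where G = "\<lambda>s r. rl_term (\<kappa> + \<sigma>) (\<rho> + \<eta>) U (s, r) z", OF this]
  have "((\<lambda>(s, r). e (s, r) * rl_term (\<kappa> + \<sigma>) (\<rho> + \<eta>) U (s, r) z)
      has_sum convolution (rl_series \<kappa> \<rho> U c) (rl_series \<sigma> \<eta> U d) z) UNIV"
    unfolding e .
  from suminf_suminf_eq[OF this] show ?thesis
    by (simp only: rl_series_def prod.case)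
qed

subsection \<open>The kernel of the operator\<close>

text \<open>Here \<open>n = \<nu>1\<close>, \<open>N = \<nu>2 powr U\<close>, and \<open>g\<close>, \<open>h\<close> are the first two upper parameters.\<close>

definition hk_series_coeff :: "complex \<Rightarrow> complex \<Rightarrow> complex \<Rightarrow> complex \<Rightarrow> nat \<times> nat \<Rightarrow> complex" where
  "hk_series_coeff n N g h = (\<lambda>(s, r). 4 ^ s * pochhammer (g / 2) s * pochhammer (h + of_nat s) r * n ^ s * N ^ r /
     (fact s * fact r))"

section \<open>Algebra and growth of the coefficients\<close>

lemma pochhammer_Vandermonde_fact:
  fixes a b :: "'a::field_char_0"
  shows "pochhammer (a + b) n / fact n
    = (\<Sum>k\<le>n. (pochhammer a k / fact k) * (pochhammer b (n - k) / fact (n - k)))"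
  unfolding pochhammer_binomial_sum sum_divide_distrib
  by (intro sum.cong) (auto simp: binomial_fact field_simps)

text \<open>The Vandermonde sum over \<open>r'\<close> adds the parameters \<open>h + s'\<close> and
  \<open>h' + (s - s')\<close>, and their total \<open>h + h' + s\<close> does not depend on
  \<open>s'\<close>. So the inner sum leaves the outer one, where a second Vandermonde sum in
  \<open>g / 2\<close> and \<open>g' / 2\<close> remains.\<close>

lemma hk_series_coeff_Cauchy_product:
  "(\<Sum>s'\<le>s. \<Sum>r'\<le>r. hk_series_coeff n N g h (s', r') * hk_series_coeff n N g' h' (s - s', r - r'))
     = hk_series_coeff n N (g + g') (h + h') (s, r)"
proof -
  let ?P = "\<lambda>a k. pochhammer a k / fact k :: complex"
  have "(\<Sum>r'\<le>r. hk_series_coeff n N g h (s', r') * hk_series_coeff n N g' h' (s - s', r - r'))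
      = 4 ^ s * n ^ s * N ^ r * ?P (h + h' + of_nat s) r * (?P (g / 2) s' * ?P (g' / 2) (s - s'))"
    if s': "s' \<le> s" for s'
  proof -
    have pw: "x ^ s' * x ^ (s - s') = x ^ s" for x :: complex
      using s' by (simp flip: power_add)
    have "hk_series_coeff n N g h (s', r') * hk_series_coeff n N g' h' (s - s', r - r')
        = 4 ^ s * n ^ s * N ^ r * (?P (g / 2) s' * ?P (g' / 2) (s - s')) *
          (?P (h + of_nat s') r' * ?P (h' + of_nat (s - s')) (r - r'))" if "r' \<le> r" for r'
    proof -
      have "N ^ r' * N ^ (r - r') = N ^ r"
        using that by (simp flip: power_add)
      then show ?thesis
        unfolding hk_series_coeff_def pw[symmetric] by (simp add: mult_ac)
    qed
    then have "(\<Sum>r'\<le>r. hk_series_coeff n N g h (s', r') * hk_series_coeff n N g' h' (s - s', r - r'))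
        = 4 ^ s * n ^ s * N ^ r * (?P (g / 2) s' * ?P (g' / 2) (s - s')) *
          (\<Sum>r'\<le>r. ?P (h + of_nat s') r' * ?P (h' + of_nat (s - s')) (r - r'))"
      unfolding sum_distrib_left by (intro sum.cong) auto
    also have "(\<Sum>r'\<le>r. ?P (h + of_nat s') r' * ?P (h' + of_nat (s - s')) (r - r'))
        = ?P (h + h' + of_nat s) r"
      unfolding pochhammer_Vandermonde_fact[symmetric] using s' by (simp add: of_nat_diff algebra_simps)
    finally show ?thesis by (simp only: mult_ac)
  qed
  then have "(\<Sum>s'\<le>s. \<Sum>r'\<le>r. hk_series_coeff n N g h (s', r') * hk_series_coeff n N g' h' (s - s', r - r'))
      = 4 ^ s * n ^ s * N ^ r * ?P (h + h' + of_nat s) r * (\<Sum>s'\<le>s. ?P (g / 2) s' * ?P (g' / 2) (s - s'))"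
    unfolding sum_distrib_left by (intro sum.cong) auto
  also have "(\<Sum>s'\<le>s. ?P (g / 2) s' * ?P (g' / 2) (s - s')) = ?P ((g + g') / 2) s"
    unfolding pochhammer_Vandermonde_fact[symmetric] by (simp add: add_divide_distrib)
  finally show ?thesis by (simp add: hk_series_coeff_def mult_ac)
qed

text \<open>Comparison with the rising factorial starting at \<open>m + 1\<close>, which divided by
  \<open>fact k\<close> is exactly a binomial coefficient.\<close>

lemma norm_pochhammer_fact_le:
  fixes a :: complex
  assumes "norm a \<le> real m"
  shows "norm (pochhammer a k) / fact k \<le> 2 ^ (m + k)"
proof -
  have "norm (pochhammer a k) \<le> pochhammer (real (Suc m)) k"
    unfolding pochhammer_prod prod_norm[symmetric]
  proof (intro prod_mono conjI)
    fix i
    show "norm (a + of_nat i) \<le> real (Suc m) + real i"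
      using norm_triangle_ineq[of a "of_nat i"] assms by simp
  qed auto
  also have "pochhammer (real (Suc m)) k = fact k * real ((m + k) choose k)"
  proof -
    have "fact m * pochhammer (real (Suc m)) k = fact (m + k)"
      unfolding pochhammer_fact pochhammer_product' by (simp add: add.commute)
    moreover have "fact k * fact m * real ((m + k) choose k) = fact (m + k)"
      using arg_cong[OF binomial_fact_lemma[of k "m + k"], of real] by simp
    ultimately have "fact m * pochhammer (real (Suc m)) k = fact m * (fact k * real ((m + k) choose k))"
      by (simp only: mult_ac)
    then show ?thesis by simp
  qed
  finally have "norm (pochhammer a k) / fact k \<le> real ((m + k) choose k)"
    by (simp add: field_simps)
  also have "\<dots> \<le> 2 ^ (m + k)"
    using binomial_le_pow2[of "m + k" k] by (metis of_nat_le_iff of_nat_numeral of_nat_power)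
  finally show ?thesis .
qed

text \<open>The shift in \<open>pochhammer (h + of_nat s) r\<close> couples the two indices but
  costs only a factor \<open>2 ^ s\<close>. Hence a product of two single series, both covered by
  \<open>summable_rGamma_powers\<close>, dominates.\<close>

lemma hk_series_coeff_admissible:
  assumes re: "Re \<kappa> > 0" "Re \<rho> > 0" "Re U > 0"
  shows "rl_admissible \<kappa> \<rho> U (hk_series_coeff n N g h)"
  unfolding rl_admissible_def
proof (intro allI impI)
  fix L M :: real
  assume L: "L \<ge> 0"
  obtain m1 m2 :: nat where m: "norm (g / 2) \<le> real m1" "norm h \<le> real m2"
    using real_arch_simple by metis
  \<comment> \<open>16 is the 4 of the duplication formula times a 2 from each of the two Pochhammer
    bounds, the second one caused by the shift by \<open>s\<close>.\<close>
  define K1 K2 where "K1 = 16 * norm n * L" and "K2 = 2 * norm N * (M powr Re U)"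
  define C where "C = norm (Gamma \<kappa>) * norm (Gamma \<rho>) * 2 ^ (m1 + m2)"
  have "(\<lambda>s. norm (rGamma (\<kappa> + of_nat s)) * K1 ^ s) summable_on UNIV"
    using summable_rGamma_powers[of \<kappa> 1 K1] re L by (simp add: summable_on_UNIV_nonneg_real_iff K1_def)
  moreover have "(\<lambda>r. norm (rGamma (\<rho> + U * of_nat r)) * K2 ^ r) summable_on UNIV"
    using summable_rGamma_powers[of \<rho> U K2] re by (simp add: summable_on_UNIV_nonneg_real_iff K2_def)
  ultimately have "(\<lambda>(s, r). (norm (rGamma (\<kappa> + of_nat s)) * K1 ^ s) * (norm (rGamma (\<rho> + U * of_nat r)) * K2 ^ r))
      summable_on UNIV \<times> UNIV"
    by (rule summable_on_times) (use L in \<open>auto simp: K1_def K2_def\<close>)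
  then have "(\<lambda>i. C * (case i of (s, r) \<Rightarrow> (norm (rGamma (\<kappa> + of_nat s)) * K1 ^ s) * (norm (rGamma (\<rho> + U * of_nat r)) * K2 ^ r)))
      summable_on UNIV"
    by (intro summable_on_cmult_right) simp
  then show "(\<lambda>i. norm (hk_series_coeff n N g h i) * rl_bound \<kappa> \<rho> U L M i) summable_on UNIV"
  proof (rule summable_on_comparison_test)
    fix i :: "nat \<times> nat"
    obtain s r where i: "i = (s, r)" by (cases i)
    have "norm (h + of_nat s) \<le> real (m2 + s)"
      using norm_triangle_ineq[of h "of_nat s"] m by simp
    then have p2: "norm (pochhammer (h + of_nat s) r) / fact r \<le> 2 ^ (m2 + s + r)"
      by (rule norm_pochhammer_fact_le)
    have "norm (hk_series_coeff n N g h i) = 4 ^ s * norm n ^ s * norm N ^ r *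
        ((norm (pochhammer (g / 2) s) / fact s) * (norm (pochhammer (h + of_nat s) r) / fact r))"
      by (simp add: i hk_series_coeff_def norm_mult norm_divide norm_power)
    also have "\<dots> \<le> 4 ^ s * norm n ^ s * norm N ^ r * (2 ^ (m1 + s) * 2 ^ (m2 + s + r))"
      by (intro mult_left_mono mult_mono norm_pochhammer_fact_le m p2) auto
    also have "\<dots> = 2 ^ (m1 + m2) * ((16 * norm n) ^ s * (2 * norm N) ^ r)"
    proof -
      have "(16::real) ^ s = (4 * 2 * 2) ^ s"
        by simp
      then show ?thesis
        by (simp only: power_add power_mult_distrib mult_ac)
    qed
    finally have "norm (hk_series_coeff n N g h i) * rl_bound \<kappa> \<rho> U L M i
        \<le> 2 ^ (m1 + m2) * ((16 * norm n) ^ s * (2 * norm N) ^ r) * rl_bound \<kappa> \<rho> U L M i"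
      using L by (intro mult_right_mono) (auto simp: rl_bound_def)
    also have "\<dots> = C * (case i of (s, r) \<Rightarrow> (norm (rGamma (\<kappa> + of_nat s)) * K1 ^ s) * (norm (rGamma (\<rho> + U * of_nat r)) * K2 ^ r))"
      unfolding i rl_bound_def C_def K1_def K2_def power_mult_distrib prod.case fst_conv snd_conv
      by (simp only: mult_ac)
    finally show "norm (hk_series_coeff n N g h i) * rl_bound \<kappa> \<rho> U L M i
        \<le> C * (case i of (s, r) \<Rightarrow> (norm (rGamma (\<kappa> + of_nat s)) * K1 ^ s) * (norm (rGamma (\<rho> + U * of_nat r)) * K2 ^ r))" .
  qed (use L in \<open>auto simp: rl_bound_def\<close>)
qed

section \<open>From the Mittag-Leffler function to the kernel series\<close>

text \<open>The principal power of \<open>\<nu>2 * y\<close> splits because \<open>y\<close> is a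
  positive real. Summability of the Mittag-Leffler series is inherited from the kernel series by
  dividing by the nonzero prefactor \<open>?K\<close>.\<close>

lemma hk_kernel_eq_rl_series:
  assumes re: "Re \<kappa> > 0" "Re \<rho> > 0" "Re U > 0" and pos: "x > 0" "y > 0"
  shows "of_real x powr (\<kappa> - 1) * of_real y powr (\<rho> - 1) *
      hk_mittag_leffler \<kappa> \<rho> U g h ((g + 1) / 2) h (\<nu>1 * of_real x) (\<nu>2 * of_real y)
    = rl_series \<kappa> \<rho> U (hk_series_coeff \<nu>1 (\<nu>2 powr U) g h) (x, y)" (is "?K * _ = ?S")
proof -
  let ?c = "hk_series_coeff \<nu>1 (\<nu>2 powr U) g h"
  let ?t = "\<lambda>(s, r). hk_coeff g h ((g + 1) / 2) h s r * (\<nu>1 * of_real x) ^ s * ((\<nu>2 * of_real y) powr U) ^ r /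
      (Gamma (\<kappa> + of_nat s) * Gamma (\<rho> + U * of_nat r) * fact r * fact s)"
  have cancel: "inverse k * (k * t) = t" "k * (inverse k * t) = t" if "k \<noteq> 0" for k t :: complex
    using that by simp_all
  have K: "?K \<noteq> 0" using pos by simp
  have "?c (s, r) * rl_term \<kappa> \<rho> U (s, r) (x, y) = ?K * ?t (s, r)" for s r
  proof -
    have e1: "complex_of_real x powr (\<kappa> + of_nat s - 1) = of_real x powr (\<kappa> - 1) * of_real x ^ s"
      unfolding diff_add_eq[symmetric] powr_add using pos by (simp add: powr_nat')
    have e2: "complex_of_real y powr (\<rho> + U * of_nat r - 1) = of_real y powr (\<rho> - 1) * (of_real y powr U) ^ r"
    proof -
      have "complex_of_real y powr (U * of_nat r) = (of_real y powr U) ^ r"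
        using pos by (simp add: powr_def exp_of_nat_mult[symmetric] mult_ac)
      then show ?thesis
        unfolding diff_add_eq[symmetric] powr_add by simp
    qed
    have e3: "(\<nu>2 * of_real y) powr U = \<nu>2 powr U * of_real y powr U"
      using powr_times_real_left[of "of_real y" \<nu>2 U] pos by (simp add: mult.commute)
    have "rl_kernel (\<kappa> + of_nat s) x = of_real x powr (\<kappa> - 1) * of_real x ^ s * inverse (Gamma (\<kappa> + of_nat s))"
      "rl_kernel (\<rho> + U * of_nat r) y
        = of_real y powr (\<rho> - 1) * (of_real y powr U) ^ r * inverse (Gamma (\<rho> + U * of_nat r))"
      using pos by (simp_all only: rl_kernel_def if_True rGamma_inverse_Gamma e1 e2)
    then show ?thesis
      unfolding hk_series_coeff_def rl_term_def hk_coeff_family prod.case fst_conv snd_conv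
      by (simp only: e3 power_mult_distrib divide_inverse inverse_mult_distrib mult_ac)
  qed
  then have "(\<lambda>i. ?c i * rl_term \<kappa> \<rho> U i (x, y)) = (\<lambda>i. ?K * ?t i)"
    unfolding fun_eq_iff split_paired_All by blast
  then have "((\<lambda>i. ?K * ?t i) has_sum ?S) UNIV"
    using rl_series_has_sum[OF hk_series_coeff_admissible[OF re] re, of \<nu>1 "\<nu>2 powr U" g h "(x, y)"]
    by (simp only:)
  moreover have "inverse ?K * (?K * ?t i) = ?t i" for i
    by (rule cancel(1)[OF K])
  ultimately have "(?t has_sum inverse ?K * ?S) UNIV"
    using has_sum_cmult_right[where c = "inverse ?K" and f = "\<lambda>i. ?K * ?t i"] by (simp only:)
  from suminf_suminf_eq[OF this]
  have "hk_mittag_leffler \<kappa> \<rho> U g h ((g + 1) / 2) h (\<nu>1 * of_real x) (\<nu>2 * of_real y) = inverse ?K * ?S"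
    unfolding hk_mittag_leffler_def prod.case .
  then show ?thesis by (simp only: cancel(2)[OF K])
qed

text \<open>For \<open>s > 0\<close> the limiting branch of \<open>hk_coeff\<close> applies, and the
  cancelled form still contains \<open>pochhammer 0 s = 0\<close>; for \<open>s = 0\<close> the
  factor \<open>pochhammer 0 r\<close> removes all \<open>r > 0\<close>.\<close>

lemma hk_mittag_leffler_zero:
  "hk_mittag_leffler \<kappa> \<rho> U 0 0 (1 / 2) 0 X Y = 1 / (Gamma \<kappa> * Gamma \<rho>)"
proof -
  let ?t = "\<lambda>(s, r). hk_coeff 0 0 (1 / 2) 0 s r * X ^ s * (Y powr U) ^ r /
      (Gamma (\<kappa> + of_nat s) * Gamma (\<rho> + U * of_nat r) * fact r * fact s)"
  have "hk_coeff 0 0 (1 / 2) 0 s r = (if s = 0 \<and> r = 0 then 1 else 0)" for s r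
    using hk_coeff_family[of 0 0 s r] by (cases s; cases r) (auto simp: pochhammer_0_left)
  then have "(?t has_sum 1 / (Gamma \<kappa> * Gamma \<rho>)) UNIV"
    by (intro has_sum_finite_neutralI[where B = "{(0, 0)}"]) (auto split: if_splits)
  from suminf_suminf_eq[OF this] show ?thesis
    unfolding hk_mittag_leffler_def prod.case .
qed

subsection \<open>The operator as a convolution\<close>

text \<open>Measurability of \<open>g\<close> comes from completeness of the Lebesgue measure, so an
  integrand known only almost everywhere can be exchanged for a Borel one.\<close>

lemma lebesgue_integral_AE_eq:
  fixes f g :: "'a::euclidean_space \<Rightarrow> 'b::euclidean_space"
  assumes f: "f \<in> borel_measurable borel" and ae: "AE x in lborel. g x = f x"
  shows "integral\<^sup>L lebesgue g = integral\<^sup>L lborel f"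
proof -
  have ae': "AE x in lebesgue. g x = f x" "AE x in lebesgue. f x = g x"
    using AE_completion[OF ae] by (auto elim: eventually_mono)
  have f': "f \<in> borel_measurable lebesgue"
    using f by (simp add: measurable_completion)
  have "integral\<^sup>L lebesgue g = integral\<^sup>L lebesgue f"
    by (rule integral_cong_AE) (use borel_measurable_AE[OF f' ae'(2)] f' ae' in auto)
  also have "\<dots> = integral\<^sup>L lborel f"
    using f by (intro integral_completion) simp
  finally show ?thesis .
qed

text \<open>The order matches the operator, whose outer variable is the second coordinate. Enlarging
  the exceptional set to a Borel null set \<open>N\<close> makes Fubini and the swap of the two
  quantifiers applicable.\<close>

lemma AE_lborel_snd_fst:
  assumes "AE z in lborel. P (z :: 'a::euclidean_space \<times> 'b::euclidean_space)"
  shows "AE y in lborel. AE x in lborel. P (x, y)"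
proof -
  obtain N where N: "{z. \<not> P z} \<subseteq> N" "N \<in> sets borel" "emeasure lborel N = 0"
    using assms by (auto elim!: AE_E)
  have "AE z in lborel. z \<notin> N"
    using N by (intro AE_not_in) auto
  then have "AE z in lborel \<Otimes>\<^sub>M lborel. z \<notin> N"
    unfolding lborel_prod .
  then have "AE x in lborel. AE y in lborel. (x, y) \<notin> N"
    by (rule lborel_pair.AE_pair)
  moreover have "{z \<in> space (lborel \<Otimes>\<^sub>M lborel). (fst z, snd z) \<notin> N} \<in> sets (lborel \<Otimes>\<^sub>M lborel)"
    unfolding lborel_prod using N(2) by (simp add: Collect_neg_eq)
  ultimately have "AE y in lborel. AE x in lborel. (x, y) \<notin> N"
    using lborel_pair.AE_commute[of "\<lambda>x y. (x, y) \<notin> N"] by simp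
  then show ?thesis
    using N(1) by (auto elim!: eventually_mono)
qed

lemma completion_ex_borel_measurable_complex:
  fixes f :: "'a \<Rightarrow> complex"
  assumes "f \<in> borel_measurable (completion M)"
  shows "\<exists>g\<in>borel_measurable M. AE x in M. f x = g x"
proof -
  have "(\<lambda>x. Re (f x)) \<in> borel_measurable (completion M)" "(\<lambda>x. Im (f x)) \<in> borel_measurable (completion M)"
    using assms by measurable
  then obtain u v where u: "u \<in> borel_measurable M" "AE x in M. Re (f x) = u x"
    and v: "v \<in> borel_measurable M" "AE x in M. Im (f x) = v x"
    using completion_ex_borel_measurable_real by metis
  show ?thesis
  proof (rule bexI[where x = "\<lambda>x. Complex (u x) (v x)"])
    show "(\<lambda>x. Complex (u x) (v x)) \<in> borel_measurable M"
      using u v by (simp add: borel_measurable_complex_iff)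
    show "AE x in M. f x = Complex (u x) (v x)"
      using u(2) v(2) by eventually_elim (simp add: complex_eq_iff)
  qed
qed

lemma L1_rect_borel_representative:
  assumes "L1_rect A B C D \<psi>"
  obtains \<Phi> where "\<Phi> \<in> borel_measurable borel"
    "integrable lborel (\<lambda>z. indicator ({A<..<B} \<times> {C<..<D}) z * \<Phi> z)"
    "AE z in lborel. z \<in> {A<..<B} \<times> {C<..<D} \<longrightarrow> \<psi> (fst z) (snd z) = \<Phi> z"
proof -
  let ?R = "{A<..<B} \<times> {C<..<D}"
  let ?f = "\<lambda>z. indicator ?R z *\<^sub>R (case z of (x, y) \<Rightarrow> \<psi> x y)"
  have f: "integrable lebesgue ?f"
    using assms by (simp add: L1_rect_def set_integrable_def)
  then have "?f \<in> borel_measurable lebesgue"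
    by (rule borel_measurable_integrable)
  from completion_ex_borel_measurable_complex[OF this]
  obtain \<Phi> where m: "\<Phi> \<in> borel_measurable lborel" and ae: "AE z in lborel. ?f z = \<Phi> z"
    by blast
  have m' [measurable]: "\<Phi> \<in> borel_measurable borel" and [measurable]: "?R \<in> sets borel"
    using m by (auto intro!: borel_open open_Times)
  have "integrable lebesgue (\<lambda>z. indicator ?R z * \<Phi> z)"
  proof (rule integrable_cong_AE_imp[OF f])
    show "(\<lambda>z. indicator ?R z * \<Phi> z) \<in> borel_measurable lebesgue"
      by (rule measurable_completion) measurable
    show "AE z in lebesgue. ?f z = indicator ?R z * \<Phi> z"
      using AE_completion[OF ae]
    proof eventually_elim
      case (elim z)
      then show ?case
        by (cases "z \<in> ?R")
           (simp_all only: indicator_simps simp_thms scaleR_one mult_1_left scaleR_zero_left mult_zero_left)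
    qed
  qed
  then have "integrable lborel (\<lambda>z. indicator ?R z * \<Phi> z)"
    by (subst (asm) integrable_completion) measurable
  moreover have "AE z in lborel. z \<in> ?R \<longrightarrow> \<psi> (fst z) (snd z) = \<Phi> z"
    using ae by eventually_elim (auto simp: case_prod_unfold)
  ultimately show thesis
    by (rule that[OF m'])
qed

text \<open>The lower limits \<open>A\<close>, \<open>C\<close> are enforced by the indicator of
  \<open>R\<close>, the upper limits \<open>X\<close>, \<open>Y\<close> by the vanishing of
  \<open>K\<close> at nonpositive arguments. For almost every \<open>w\<close> the inner integrals
  agree, and the outer integral ignores the other \<open>w\<close>.\<close>

lemma iterated_integral_eq_convolution:
  fixes A B C D X Y :: real and K \<Phi> :: "real \<times> real \<Rightarrow> complex" and \<phi> h :: "real \<Rightarrow> real \<Rightarrow> complex"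
  defines "R \<equiv> {A<..<B} \<times> {C<..<D}"
  assumes K [measurable]: "K \<in> borel_measurable borel" and \<Phi> [measurable]: "\<Phi> \<in> borel_measurable borel"
    and K0: "\<And>z. fst z \<le> 0 \<or> snd z \<le> 0 \<Longrightarrow> K z = 0"
    and ae: "AE z in lborel. z \<in> R \<longrightarrow> \<phi> (fst z) (snd z) = \<Phi> z"
    and XY: "(X, Y) \<in> R"
    and int: "integrable lborel (\<lambda>u. K ((X, Y) - u) * (indicator R u * \<Phi> u))"
    and h: "\<And>t w. t < X \<Longrightarrow> w < Y \<Longrightarrow> h t w = K (X - t, Y - w) * \<phi> t w"
  shows "(LINT w:{C<..<Y}|lebesgue. (LINT t:{A<..<X}|lebesgue. h t w)) = convolution K (\<lambda>u. indicator R u * \<Phi> u) (X, Y)"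
proof -
  define F where "F = (\<lambda>t w. K (X - t, Y - w) * (indicator R (t, w) * \<Phi> (t, w)))"
  have [measurable]: "R \<in> sets borel"
    unfolding R_def by (intro borel_open open_Times) auto
  have "(\<lambda>u. K ((X, Y) - u) * (indicator R u * \<Phi> u)) \<in> borel_measurable borel"
    by measurable
  then have Fm [measurable]: "case_prod F \<in> borel_measurable (borel \<Otimes>\<^sub>M borel)"
    by (simp add: F_def case_prod_unfold borel_prod minus_prod_def)
  have inner: "AE w in lborel. indicator {C<..<Y} w *\<^sub>R (LINT t:{A<..<X}|lebesgue. h t w) = (\<integral>t. F t w \<partial>lborel)"
    using AE_lborel_snd_fst[OF ae]
  proof eventually_elim
    case (elim w)
    show ?case
    proof (cases "w \<in> {C<..<Y}")
      case True
      have "(LINT t:{A<..<X}|lebesgue. h t w) = (\<integral>t. F t w \<partial>lborel)"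
        unfolding set_lebesgue_integral_def
      proof (rule lebesgue_integral_AE_eq)
        show "AE t in lborel. indicator {A<..<X} t *\<^sub>R h t w = F t w"
          using elim
        proof eventually_elim
          case (elim t)
          show ?case
          proof (cases "t \<in> {A<..<X}")
            case True
            then show ?thesis
              using elim \<open>w \<in> {C<..<Y}\<close> XY by (simp add: F_def R_def h)
          next
            case False
            then have "(t, w) \<notin> R \<or> K (X - t, Y - w) = 0"
              using K0[of "(X - t, Y - w)"] by (auto simp: R_def)
            with False show ?thesis by (auto simp: F_def)
          qed
        qed
      qed measurable
      with True show ?thesis by simp
    next
      case False
      then have "(t, w) \<notin> R \<or> K (X - t, Y - w) = 0" for t
        using K0[of "(X - t, Y - w)"] by (auto simp: R_def)
      then have "F t w = 0" for t
        unfolding F_def by (metis indicator_simps(2) mult_zero_left mult_zero_right)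
      with False show ?thesis by simp
    qed
  qed
  have "(LINT w:{C<..<Y}|lebesgue. (LINT t:{A<..<X}|lebesgue. h t w)) = (\<integral>w. \<integral>t. F t w \<partial>lborel \<partial>lborel)"
    unfolding set_lebesgue_integral_def[of lebesgue "{C<..<Y}"]
    by (rule lebesgue_integral_AE_eq[OF _ inner]) measurable
  also have "\<dots> = integral\<^sup>L (lborel \<Otimes>\<^sub>M lborel) (case_prod F)"
    by (rule lborel_pair.integral_snd)
       (use int in \<open>simp add: F_def case_prod_unfold lborel_prod minus_prod_def\<close>)
  also have "\<dots> = convolution K (\<lambda>u. indicator R u * \<Phi> u) (X, Y)"
    by (simp add: convolution_def F_def case_prod_unfold lborel_prod minus_prod_def)
  finally show ?thesis .
qed

text \<open>
  The full kernel need not be integrable on the plane, and for arguments in the rectangle only its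
  values on \<open>{..<B - A} \<times> {..<D - C}\<close> matter.
\<close>

definition rl_series_trunc ::
    "real \<Rightarrow> real \<Rightarrow> complex \<Rightarrow> complex \<Rightarrow> complex \<Rightarrow> (nat \<times> nat \<Rightarrow> complex) \<Rightarrow> real \<times> real \<Rightarrow> complex" where
  "rl_series_trunc L M \<kappa> \<rho> U c z = indicator ({..<L} \<times> {..<M}) z * rl_series \<kappa> \<rho> U c z"

lemma rl_series_trunc_eq_0: "fst z \<le> 0 \<or> snd z \<le> 0 \<Longrightarrow> rl_series_trunc L M \<kappa> \<rho> U c z = 0"
  by (simp add: rl_series_trunc_def rl_series_eq_0)

lemma rl_series_trunc_measurable [measurable]: "rl_series_trunc L M \<kappa> \<rho> U c \<in> borel_measurable borel"
proof -
  have [measurable]: "{..<L} \<times> {..<M} \<in> sets borel"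
    by (intro borel_open open_Times) auto
  show ?thesis unfolding rl_series_trunc_def[abs_def] by measurable
qed

text \<open>On the box the series is at most \<open>S\<close> times the product of the two leading
  kernels, whose truncations are integrable in one variable each.\<close>

lemma integrable_rl_series_trunc:
  assumes adm: "rl_admissible \<kappa> \<rho> U c" and re: "Re \<kappa> > 0" "Re \<rho> > 0" "Re U > 0" and L: "L \<ge> 0" and M: "M \<ge> 0"
  shows "integrable lborel (rl_series_trunc L M \<kappa> \<rho> U c)"
proof -
  define S where "S = infsum (\<lambda>i. norm (c i) * rl_bound \<kappa> \<rho> U L M i) UNIV"
  have S: "((\<lambda>i. norm (c i) * rl_bound \<kappa> \<rho> U L M i) has_sum S) UNIV"
    unfolding S_def using adm L by (intro has_sum_infsum) (auto simp: rl_admissible_def)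
  let ?W = "\<lambda>z. (indicator {..<L} (fst z) * rl_kernel \<kappa> (fst z)) * (indicator {..<M} (snd z) * rl_kernel \<rho> (snd z))"
  have le: "norm (rl_series_trunc L M \<kappa> \<rho> U c z) \<le> S * norm (?W z)" for z
  proof (cases "z \<in> {..<L} \<times> {..<M}")
    case True
    then have z: "fst z \<le> L" "snd z \<le> M" by auto
    have "norm (rl_series \<kappa> \<rho> U c z) \<le> S * norm (rl_kernel \<kappa> (fst z) * rl_kernel \<rho> (snd z))"
    proof (rule norm_infsum_le[OF rl_series_has_sum[OF adm re] has_sum_cmult_left[OF S]])
      fix i
      show "norm (c i * rl_term \<kappa> \<rho> U i z)
          \<le> norm (c i) * rl_bound \<kappa> \<rho> U L M i * norm (rl_kernel \<kappa> (fst z) * rl_kernel \<rho> (snd z))"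
        unfolding norm_mult[of "c i"] mult.assoc
        by (intro mult_left_mono norm_rl_term_le z re L M norm_ge_zero)
    qed
    with True show ?thesis by (auto simp: rl_series_trunc_def)
  next
    case False
    then have "norm (rl_series_trunc L M \<kappa> \<rho> U c z) = 0" "norm (?W z) = 0"
      by (auto simp: rl_series_trunc_def indicator_def mem_Times_iff)
    then show ?thesis by (simp only: mult_zero_right order_refl)
  qed
  have W: "integrable lborel ?W"
    by (intro integrable_lborel_times integrable_rl_kernel_truncated re)
  show ?thesis
  proof (rule Bochner_Integration.integrable_bound)
    show "integrable lborel (\<lambda>z. S * norm (?W z))"
      by (intro integrable_mult_right integrable_norm W)
    show "AE z in lborel. norm (rl_series_trunc L M \<kappa> \<rho> U c z) \<le> norm (S * norm (?W z))"
      using order_trans[OF le abs_ge_self] by (intro AE_I2) (simp only: real_norm_def)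
  qed measurable
qed

text \<open>The integrand vanishes unless \<open>0 < u < z\<close> componentwise, and then neither
  \<open>u\<close> nor \<open>z - u\<close> reaches the edge of the box.\<close>

lemma rl_series_trunc_convolution:
  assumes z: "fst z < L" "snd z < M"
  shows "convolution (rl_series_trunc L M \<kappa> \<rho> U c) (rl_series_trunc L M \<sigma> \<eta> U d) z
    = convolution (rl_series \<kappa> \<rho> U c) (rl_series \<sigma> \<eta> U d) z"
proof -
  have "rl_series_trunc L M \<kappa> \<rho> U c (z - u) * rl_series_trunc L M \<sigma> \<eta> U d u
      = rl_series \<kappa> \<rho> U c (z - u) * rl_series \<sigma> \<eta> U d u" for u
  proof (cases "0 < fst u \<and> 0 < snd u \<and> fst u < fst z \<and> snd u < snd z")
    case True
    then have "u \<in> {..<L} \<times> {..<M}" "z - u \<in> {..<L} \<times> {..<M}"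
      using z by (auto simp: mem_Times_iff)
    then show ?thesis by (simp only: rl_series_trunc_def indicator_simps simp_thms mult_1_left)
  next
    case False
    then have "(fst u \<le> 0 \<or> snd u \<le> 0) \<or> (fst (z - u) \<le> 0 \<or> snd (z - u) \<le> 0)" by auto
    then show ?thesis
      using rl_series_eq_0 rl_series_trunc_eq_0 by (metis mult_zero_left mult_zero_right)
  qed
  then show ?thesis by (simp only: convolution_def)
qed

text \<open>\<open>\<phi>\<close> enters only through a representative, so the lemma also applies to
  the output of another operator. Truncation is invisible because differences of points of
  \<open>R\<close> stay in the box of sides \<open>B - A\<close> and \<open>D - C\<close>.\<close>

lemma hk_integral_eq_convolution:
  fixes A B C D :: real and \<Phi> :: "real \<times> real \<Rightarrow> complex"
  defines "R \<equiv> {A<..<B} \<times> {C<..<D}"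
  assumes AB: "A < B" "C < D" and re: "Re \<kappa> > 0" "Re \<rho> > 0" "Re U > 0"
    and \<Phi> [measurable]: "\<Phi> \<in> borel_measurable borel"
    and int: "integrable lborel (\<lambda>z. indicator R z * \<Phi> z)"
    and ae: "AE z in lborel. z \<in> R \<longrightarrow> \<phi> (fst z) (snd z) = \<Phi> z"
  shows "AE z in lborel. z \<in> R \<longrightarrow>
    hk_integral A C \<kappa> \<rho> U \<nu>1 \<nu>2 g h ((g + 1) / 2) h \<phi> (fst z) (snd z)
    = convolution (rl_series_trunc (B - A) (D - C) \<kappa> \<rho> U (hk_series_coeff \<nu>1 (\<nu>2 powr U) g h)) (\<lambda>u. indicator R u * \<Phi> u) z"
proof -
  let ?c = "hk_series_coeff \<nu>1 (\<nu>2 powr U) g h"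
  let ?k = "rl_series \<kappa> \<rho> U ?c"
  let ?kT = "rl_series_trunc (B - A) (D - C) \<kappa> \<rho> U ?c"
  have "integrable lborel ?kT"
    using AB by (intro integrable_rl_series_trunc hk_series_coeff_admissible re) auto
  from convolution_AE_integrable[OF this int] show ?thesis
  proof eventually_elim
    case (elim z)
    show ?case
    proof
      assume z: "z \<in> R"
      have trunc: "?kT (z - u) * (indicator R u * \<Phi> u) = ?k (z - u) * (indicator R u * \<Phi> u)" for u
      proof (cases "u \<in> R")
        case True
        then have "z - u \<in> {..<B - A} \<times> {..<D - C}"
          using z by (auto simp: R_def mem_Times_iff)
        then show ?thesis by (simp add: rl_series_trunc_def)
      qed simp
      have XY: "(fst z, snd z) \<in> R" using z by simp
      have "hk_integral A C \<kappa> \<rho> U \<nu>1 \<nu>2 g h ((g + 1) / 2) h \<phi> (fst z) (snd z)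
          = convolution ?k (\<lambda>u. indicator R u * \<Phi> u) (fst z, snd z)"
        unfolding hk_integral_def R_def
      proof (rule iterated_integral_eq_convolution[where \<phi> = \<phi>])
        show "integrable lborel (\<lambda>u. ?k ((fst z, snd z) - u) * (indicator ({A<..<B} \<times> {C<..<D}) u * \<Phi> u))"
          using elim by (simp only: trunc prod.collapse R_def[symmetric])
        fix t w
        assume "t < fst z" "w < snd z"
        then show "of_real (fst z - t) powr (\<kappa> - 1) * of_real (snd z - w) powr (\<rho> - 1) *
            hk_mittag_leffler \<kappa> \<rho> U g h ((g + 1) / 2) h (\<nu>1 * of_real (fst z - t)) (\<nu>2 * of_real (snd z - w)) * \<phi> t w
          = ?k (fst z - t, snd z - w) * \<phi> t w"
          using re by (subst hk_kernel_eq_rl_series) auto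
      qed (use ae XY rl_series_eq_0 in \<open>auto simp: R_def\<close>)
      also have "\<dots> = convolution ?kT (\<lambda>u. indicator R u * \<Phi> u) z"
        by (simp only: convolution_def trunc prod.collapse)
      finally show "hk_integral A C \<kappa> \<rho> U \<nu>1 \<nu>2 g h ((g + 1) / 2) h \<phi> (fst z) (snd z)
          = convolution ?kT (\<lambda>u. indicator R u * \<Phi> u) z" .
    qed
  qed
qed

section \<open>The semigroup law and its Riemann--Liouville case\<close>

text \<open>The upper parameters are arbitrary complex numbers because the second identity
  instantiates them with \<open>- \<gamma>1\<close> and \<open>- \<gamma>2\<close>.\<close>

lemma hk_integral_semigroup:
  assumes AB: "A < B" "C < D"
    and re: "Re \<kappa> > 0" "Re \<rho> > 0" "Re \<sigma> > 0" "Re \<eta> > 0" "Re U > 0"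
    and \<psi>: "L1_rect A B C D \<psi>"
  shows "ae_eq_rect A B C D
       (hk_integral A C \<kappa> \<rho> U \<nu>1 \<nu>2 g h ((g + 1) / 2) h
         (hk_integral A C \<sigma> \<eta> U \<nu>1 \<nu>2 g' h' ((g' + 1) / 2) h' \<psi>))
       (hk_integral A C (\<kappa> + \<sigma>) (\<rho> + \<eta>) U \<nu>1 \<nu>2 (g + g') (h + h') ((g + g' + 1) / 2) (h + h') \<psi>)"
proof -
  define R where "R = {A<..<B} \<times> {C<..<D}"
  obtain \<Phi> where [measurable]: "\<Phi> \<in> borel_measurable borel"
    and int: "integrable lborel (\<lambda>z. indicator R z * \<Phi> z)"
    and ae: "AE z in lborel. z \<in> R \<longrightarrow> \<psi> (fst z) (snd z) = \<Phi> z"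
    using L1_rect_borel_representative[OF \<psi>] unfolding R_def by blast
  let ?c = "hk_series_coeff \<nu>1 (\<nu>2 powr U)"
  let ?T = "rl_series_trunc (B - A) (D - C)"
  define k1 k2 k3 where "k1 = ?T \<kappa> \<rho> U (?c g h)" and "k2 = ?T \<sigma> \<eta> U (?c g' h')"
    and "k3 = ?T (\<kappa> + \<sigma>) (\<rho> + \<eta>) U (?c (g + g') (h + h'))"
  define \<Psi> where "\<Psi> = (\<lambda>u. indicator R u * \<Phi> u)"
  define \<Phi>2 where "\<Phi>2 = convolution k2 \<Psi>"
  have k: "integrable lborel k1" "integrable lborel k2"
    unfolding k1_def k2_def using AB by (auto intro!: integrable_rl_series_trunc hk_series_coeff_admissible re)
  have \<Psi>: "integrable lborel \<Psi>"
    using int by (simp add: \<Psi>_def)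
  have \<Phi>2: "integrable lborel \<Phi>2"
    unfolding \<Phi>2_def by (intro convolution_integrable k \<Psi>)
  then have \<Phi>2m: "\<Phi>2 \<in> borel_measurable borel"
    using borel_measurable_integrable by fastforce
  have R: "R \<in> sets borel"
    unfolding R_def by (intro borel_open open_Times) auto
  have \<Phi>2R: "integrable lborel (\<lambda>z. indicator R z * \<Phi>2 z)"
    using integrable_mult_indicator[OF _ \<Phi>2, of R] R by (simp add: scaleR_conv_of_real of_real_indicator)
  have h2: "AE z in lborel. z \<in> R \<longrightarrow>
      hk_integral A C \<sigma> \<eta> U \<nu>1 \<nu>2 g' h' ((g' + 1) / 2) h' \<psi> (fst z) (snd z) = \<Phi>2 z"
    using hk_integral_eq_convolution[OF AB re(3,4,5) \<open>\<Phi> \<in> _\<close> int[unfolded R_def] ae[unfolded R_def]]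
    by (simp add: \<Phi>2_def k2_def \<Psi>_def R_def)
  have h1: "AE z in lborel. z \<in> R \<longrightarrow>
      hk_integral A C \<kappa> \<rho> U \<nu>1 \<nu>2 g h ((g + 1) / 2) h
        (hk_integral A C \<sigma> \<eta> U \<nu>1 \<nu>2 g' h' ((g' + 1) / 2) h' \<psi>) (fst z) (snd z)
      = convolution k1 (\<lambda>u. indicator R u * \<Phi>2 u) z"
    using hk_integral_eq_convolution[OF AB re(1,2,5) \<Phi>2m \<Phi>2R[unfolded R_def] h2[unfolded R_def]]
    by (simp add: k1_def R_def)
  have "Re (\<kappa> + \<sigma>) > 0" "Re (\<rho> + \<eta>) > 0"
    using re by auto
  from hk_integral_eq_convolution[OF AB this re(5) \<open>\<Phi> \<in> _\<close> int[unfolded R_def] ae[unfolded R_def]]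
  have h3: "AE z in lborel. z \<in> R \<longrightarrow>
      hk_integral A C (\<kappa> + \<sigma>) (\<rho> + \<eta>) U \<nu>1 \<nu>2 (g + g') (h + h') ((g + g' + 1) / 2) (h + h') \<psi> (fst z) (snd z)
      = convolution k3 \<Psi> z"
    by (simp add: k3_def \<Psi>_def R_def)
  have \<Phi>2_0: "\<Phi>2 u = 0" if "fst u \<le> A \<or> snd u \<le> C" for u
  proof -
    have "k2 (u - v) * \<Psi> v = 0" for v
    proof (cases "v \<in> R")
      case True
      then have "fst (u - v) \<le> 0 \<or> snd (u - v) \<le> 0"
        using that by (auto simp: R_def)
      then show ?thesis by (simp only: k2_def rl_series_trunc_eq_0 mult_zero_left)
    qed (simp add: \<Psi>_def)
    then show ?thesis
      unfolding \<Phi>2_def convolution_def by (simp only: Bochner_Integration.integral_zero)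
  qed
  have e1: "convolution k1 (\<lambda>u. indicator R u * \<Phi>2 u) z = convolution k1 (convolution k2 \<Psi>) z" if z: "z \<in> R" for z
  proof -
    have "k1 (z - u) * (indicator R u * \<Phi>2 u) = k1 (z - u) * \<Phi>2 u" for u
    proof (cases "u \<in> R")
      case False
      then have "(fst u \<le> A \<or> snd u \<le> C) \<or> (fst (z - u) \<le> 0 \<or> snd (z - u) \<le> 0)"
        using z by (auto simp: R_def mem_Times_iff)
      then have "\<Phi>2 u = 0 \<or> k1 (z - u) = 0"
        unfolding k1_def using \<Phi>2_0 rl_series_trunc_eq_0 by blast
      then show ?thesis by auto
    qed simp
    then show ?thesis by (simp only: convolution_def[of k1] \<Phi>2_def)
  qed
  \<comment> \<open>Truncated kernels may convolve to something nonzero beyond the box, where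
    \<open>k3\<close> is 0. The restriction on \<open>v\<close> suffices, since only differences of
    points of \<open>R\<close> occur.\<close>
  have k12: "convolution k1 k2 v = k3 v" if "fst v < B - A" "snd v < D - C" for v
  proof -
    have "convolution k1 k2 v = rl_series (\<kappa> + \<sigma>) (\<rho> + \<eta>) U (?c (g + g') (h + h')) v"
      unfolding k1_def k2_def rl_series_trunc_convolution[OF that]
      by (intro rl_series_convolution re hk_series_coeff_admissible hk_series_coeff_Cauchy_product[symmetric])
    also have "\<dots> = k3 v"
      using that by (simp add: k3_def rl_series_trunc_def mem_Times_iff)
    finally show ?thesis .
  qed
  have e2: "convolution (convolution k1 k2) \<Psi> z = convolution k3 \<Psi> z" if z: "z \<in> R" for z
  proof -
    have "convolution k1 k2 (z - u) * \<Psi> u = k3 (z - u) * \<Psi> u" for u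
    proof (cases "u \<in> R")
      case True
      then have "fst (z - u) < B - A" "snd (z - u) < D - C"
        using z by (auto simp: R_def)
      then show ?thesis by (simp only: k12)
    qed (simp add: \<Psi>_def)
    then show ?thesis by (simp only: convolution_def[of _ \<Psi>])
  qed
  have "AE z in lborel. z \<in> R \<longrightarrow>
      hk_integral A C \<kappa> \<rho> U \<nu>1 \<nu>2 g h ((g + 1) / 2) h
        (hk_integral A C \<sigma> \<eta> U \<nu>1 \<nu>2 g' h' ((g' + 1) / 2) h' \<psi>) (fst z) (snd z)
      = hk_integral A C (\<kappa> + \<sigma>) (\<rho> + \<eta>) U \<nu>1 \<nu>2 (g + g') (h + h') ((g + g' + 1) / 2) (h + h') \<psi> (fst z) (snd z)"
    using h1 h3 convolution_assoc_AE[OF k \<Psi>] by eventually_elim (auto simp only: e1 e2)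
  then show ?thesis
    unfolding ae_eq_rect_def AE_completion_iff R_def by (simp only: case_prod_unfold prod.collapse)
qed

theorem theorem20:
  fixes A B C D :: real
    and \<kappa> \<rho> \<sigma> \<eta> U \<nu>1 \<nu>2 \<gamma>1 \<gamma>2 \<mu>1 \<mu>2 :: complex
    and \<psi> :: "real \<Rightarrow> real \<Rightarrow> complex"
  assumes "A < B" and "C < D"
    and "Re \<kappa> > 0" and "Re \<rho> > 0" and "Re \<sigma> > 0" and "Re \<eta> > 0" and "Re U > 0"
    and "Re \<gamma>1 > 0" and "Re \<gamma>2 > 0" and "Re \<mu>1 > 0" and "Re \<mu>2 > 0"
    and "L1_rect A B C D \<psi>"
  shows
    "ae_eq_rect A B C D
       (hk_integral A C \<kappa> \<rho> U \<nu>1 \<nu>2 \<gamma>1 \<gamma>2 ((\<gamma>1 + 1) / 2) \<gamma>2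
         (hk_integral A C \<sigma> \<eta> U \<nu>1 \<nu>2 \<mu>1 \<mu>2 ((\<mu>1 + 1) / 2) \<mu>2 \<psi>))
       (hk_integral A C (\<kappa> + \<sigma>) (\<rho> + \<eta>) U \<nu>1 \<nu>2
         (\<gamma>1 + \<mu>1) (\<gamma>2 + \<mu>2) ((\<gamma>1 + \<mu>1 + 1) / 2) (\<gamma>2 + \<mu>2) \<psi>)
   \<and> ae_eq_rect A B C D
       (hk_integral A C \<kappa> \<rho> U \<nu>1 \<nu>2 \<gamma>1 \<gamma>2 ((\<gamma>1 + 1) / 2) \<gamma>2
         (hk_integral A C \<sigma> \<eta> U \<nu>1 \<nu>2 (- \<gamma>1) (- \<gamma>2) ((- \<gamma>1 + 1) / 2) (- \<gamma>2) \<psi>))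
       (hk_integral A C (\<kappa> + \<sigma>) (\<rho> + \<eta>) U \<nu>1 \<nu>2 0 0 (1 / 2) 0 \<psi>)
   \<and> ae_eq_rect A B C D
       (hk_integral A C (\<kappa> + \<sigma>) (\<rho> + \<eta>) U \<nu>1 \<nu>2 0 0 (1 / 2) 0 \<psi>)
       (rl_double_integral A C (\<rho> + \<eta>) (\<kappa> + \<sigma>) \<psi>)"
proof (intro conjI)
  note semigroup = hk_integral_semigroup[OF assms(1-7) assms(12)]
  show "ae_eq_rect A B C D
       (hk_integral A C \<kappa> \<rho> U \<nu>1 \<nu>2 \<gamma>1 \<gamma>2 ((\<gamma>1 + 1) / 2) \<gamma>2
         (hk_integral A C \<sigma> \<eta> U \<nu>1 \<nu>2 \<mu>1 \<mu>2 ((\<mu>1 + 1) / 2) \<mu>2 \<psi>))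
       (hk_integral A C (\<kappa> + \<sigma>) (\<rho> + \<eta>) U \<nu>1 \<nu>2
         (\<gamma>1 + \<mu>1) (\<gamma>2 + \<mu>2) ((\<gamma>1 + \<mu>1 + 1) / 2) (\<gamma>2 + \<mu>2) \<psi>)"
    by (rule semigroup)
  show "ae_eq_rect A B C D
       (hk_integral A C \<kappa> \<rho> U \<nu>1 \<nu>2 \<gamma>1 \<gamma>2 ((\<gamma>1 + 1) / 2) \<gamma>2
         (hk_integral A C \<sigma> \<eta> U \<nu>1 \<nu>2 (- \<gamma>1) (- \<gamma>2) ((- \<gamma>1 + 1) / 2) (- \<gamma>2) \<psi>))
       (hk_integral A C (\<kappa> + \<sigma>) (\<rho> + \<eta>) U \<nu>1 \<nu>2 0 0 (1 / 2) 0 \<psi>)"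
    using semigroup[of \<nu>1 \<nu>2 \<gamma>1 \<gamma>2 "- \<gamma>1" "- \<gamma>2"] by (simp only: add.right_inverse add_0_left)
  \<comment> \<open>An equality at every point: the Mittag-Leffler factor is constant, and a
    constant factor leaves a Bochner integral whether or not the integrand is integrable.\<close>
  have "hk_integral A C (\<kappa> + \<sigma>) (\<rho> + \<eta>) U \<nu>1 \<nu>2 0 0 (1 / 2) 0 \<psi>
      = rl_double_integral A C (\<rho> + \<eta>) (\<kappa> + \<sigma>) \<psi>"
  proof (intro ext)
    fix X Y
    have "of_real (X - t) powr (\<kappa> + \<sigma> - 1) * of_real (Y - w) powr (\<rho> + \<eta> - 1) *
          hk_mittag_leffler (\<kappa> + \<sigma>) (\<rho> + \<eta>) U 0 0 (1 / 2) 0 (\<nu>1 * of_real (X - t)) (\<nu>2 * of_real (Y - w)) * \<psi> t w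
        = 1 / (Gamma (\<rho> + \<eta>) * Gamma (\<kappa> + \<sigma>)) *
          (of_real (X - t) powr (\<kappa> + \<sigma> - 1) * of_real (Y - w) powr (\<rho> + \<eta> - 1) * \<psi> t w)" for t w
      by (simp add: hk_mittag_leffler_zero)
    then show "hk_integral A C (\<kappa> + \<sigma>) (\<rho> + \<eta>) U \<nu>1 \<nu>2 0 0 (1 / 2) 0 \<psi> X Y
        = rl_double_integral A C (\<rho> + \<eta>) (\<kappa> + \<sigma>) \<psi> X Y"
      by (simp only: hk_integral_def rl_double_integral_def set_integral_mult_right)
  qed
  then show "ae_eq_rect A B C D
       (hk_integral A C (\<kappa> + \<sigma>) (\<rho> + \<eta>) U \<nu>1 \<nu>2 0 0 (1 / 2) 0 \<psi>)
       (rl_double_integral A C (\<rho> + \<eta>) (\<kappa> + \<sigma>) \<psi>)"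
    by (simp add: ae_eq_rect_def case_prod_unfold)
qed

end
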